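(* Let $n\ge 2$ and let \[ M=\operatorname{diag}(e^{\mathrm{i}\mu_1},\ldots,e^{\mathrm{i}\mu_n}),\qquad \pi>\mu_1\ge\mu_2\ge\cdots\ge\mu_n>-\pi/2,\qquad \mu_1-\mu_n<\pi . \] Then the following hold. (i) If $\mu_1+\mu_2\le\pi$, then there is no $\Delta\in\mathbb{R}^{n\times n}$ with $\Delta+\Delta^T\succ0$ and $\det(I+M\Delta)=0$. Thus $\theta_{\mathbb{R}}(M)=+\infty$. (ii) If $\mu_1+\mu_2>\pi$, then \[ \theta_{\mathbb{R}}(M)=\arccos\!\left(-\frac{\cos((\mu_1+\mu_2)/2)}{\cos((\mu_1-\mu_2)/2)}\right). \]
   Context: For a square matrix $A$, $\operatorname{H}(A)=\tfrac12(A+A^* )$ is its Hermitian part, and $\succ0$ means positive definite. A real matrix $\Delta\in\mathbb{R}^{n\times n}$ with $\operatorname{H}(\Delta)\succ0$ (strictly accretive) is *sectorial* (i.e. $0$ is not in its numerical range $\{x^*\Delta x: x\in\mathbb{C}^n,\|x\|=1\}$), and there are an invertible $T\in\mathbb{C}^{n\times n}$ and uniquely determined numbers (the *phases* of $\Delta$) $\pi/2>\phi_1(\Delta)\ge\cdots\ge\phi_n(\Delta)>-\pi/2$ with $\Delta=T^*\operatorname{diag}(e^{\mathrm{i}\phi_1(\Delta)},\ldots,e^{\mathrm{i}\phi_n(\Delta)})T$. Equivalently for the largest phase, $\phi_1(\Delta)=\max_{x\in\mathbb{C}^n,\|x\|=1}\angle(x^*\Delta x)$, with $\angle$ the argument in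 $(-\pi/2,\pi/2)$. The real angular stability radius of $M\in\mathbb{C}^{n\times n}$ is \[ \theta_{\mathbb{R}}(M):=\inf\{\phi_1(\Delta):\Delta\in\mathbb{R}^{n\times n},\ \operatorname{H}(\Delta)\succ0,\ \det(I+M\Delta)=0\}, \] with $\inf\emptyset=+\infty$. *)

theory Defs
  imports
    "HOL-Library.Extended_Real"
    "Jordan_Normal_Form.Schur_Decomposition"
begin

definition hermitian_part :: "'a :: conjugatable_field mat \<Rightarrow> 'a mat" where
  "hermitian_part A = (1 / 2) \<cdot>\<^sub>m (A + mat_adjoint A)"

text \<open>Used for real and for complex matrices: \<open>(A *\<^sub>v x) \<bullet>c x\<close> is \<open>x\<^sup>* A x\<close>, and over the complex
  numbers \<open>0 < z\<close> (from \<open>HOL-Library.Complex_Order\<close>) means that \<open>z\<close> is real and positive.\<close>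

definition pos_def_mat :: "'a :: conjugatable_ordered_field mat \<Rightarrow> bool" where
  "pos_def_mat A \<longleftrightarrow> square_mat A \<and> mat_adjoint A = A \<and>
     (\<forall>x \<in> carrier_vec (dim_row A). x \<noteq> 0\<^sub>v (dim_row A) \<longrightarrow> 0 < (A *\<^sub>v x) \<bullet>c x)"

abbreviation complex_mat :: "real mat \<Rightarrow> complex mat" where
  "complex_mat \<equiv> map_mat complex_of_real"

definition is_phase_list :: "complex mat \<Rightarrow> real list \<Rightarrow> bool" where
  "is_phase_list A ps \<longleftrightarrow>
     length ps = dim_row A \<and> sorted_wrt (\<ge>) ps \<and> set ps \<subseteq> {- pi / 2 <..< pi / 2} \<and>
     (\<exists>T \<in> carrier_mat (dim_row A) (dim_row A). invertible_mat T \<and>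
        A = mat_adjoint T * mat_diag (dim_row A) (\<lambda>k. cis (ps ! k)) * T)"

text \<open>The phases \<open>\<phi>\<^sub>1 \<ge> \<dots> \<ge> \<phi>\<^sub>n\<close> as a list, so that \<open>\<phi>\<^sub>k\<close> is the entry at position \<open>k - 1\<close>. They exist
  and are unique for square matrices whose Hermitian part is positive definite;
  the value is meaningful only for those.\<close>

definition phases :: "complex mat \<Rightarrow> real list" where
  "phases A = (THE ps. is_phase_list A ps)"

definition largest_phase :: "complex mat \<Rightarrow> real" where
  "largest_phase A = phases A ! 0"

text \<open>For square \<open>M\<close>. The infimum is taken in \<^typ>\<open>ereal\<close>, where \<open>Inf {} = \<infinity>\<close>.\<close>

definition real_angular_stability_radius :: "complex mat \<Rightarrow> ereal" where
  "real_angular_stability_radius M =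
     Inf {ereal (largest_phase (complex_mat \<Delta>)) | \<Delta>.
            \<Delta> \<in> carrier_mat (dim_row M) (dim_row M) \<and>
            pos_def_mat (hermitian_part \<Delta>) \<and>
            det (1\<^sub>m (dim_row M) + M * complex_mat \<Delta>) = 0}"

end

theory Submission
  imports Defs
begin

text \<open>
  Let \<open>x \<noteq> 0\<close> with \<open>(I + M \<Delta>) x = 0\<close>, so \<open>(\<Delta> x)\<^sub>j = - e\<^sup>-\<^sup>i\<^sup>\<mu>\<^sup>j x\<^sub>j\<close>, and put \<open>p\<^sub>j = |x\<^sub>j|\<^sup>2\<close>,
  \<open>R + i J = x\<^sup>* \<Delta> x = \<Sum>\<^sub>j p\<^sub>j (- cos \<mu>\<^sub>j + i sin \<mu>\<^sub>j)\<close>, \<open>Q = |x\<^sup>T \<Delta> x| \<ge> p\<^sub>1 - p\<^sub>2 - \<dots> - p\<^sub>n\<close>.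
  Since \<open>\<Delta>\<close> is real, its numerical range restricted to the span of \<open>x\<close> and its conjugate is known
  explicitly. Accretivity gives \<open>Q \<le> R\<close>, which is impossible if \<open>\<mu>\<^sub>1 + \<mu>\<^sub>2 \<le> \<pi>\<close>.

  If the phases are at most \<open>\<theta>\<close>, one gets \<open>Q\<^sup>2 + J\<^sup>2 cot\<^sup>2 \<theta> \<le> R\<^sup>2\<close>. With \<open>\<sigma> = (\<mu>\<^sub>1 + \<mu>\<^sub>2) / 2\<close> and
  \<open>\<delta> = (\<mu>\<^sub>1 - \<mu>\<^sub>2) / 2\<close> one has \<open>sin (\<sigma> - \<mu>\<^sub>j) \<ge> sin \<delta>\<close> for \<open>j \<ge> 2\<close> and \<open>sin (\<sigma> - \<mu>\<^sub>1) = - sin \<delta>\<close>, hence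
  \<open>R sin \<sigma> + J cos \<sigma> \<le> Q sin \<delta>\<close>. Cauchy-Schwarz turns these two facts into
  \<open>cos \<theta> cos \<delta> \<le> - cos \<sigma>\<close>. Equality is attained by the rotation by \<open>- \<theta>\<close> in the first two coordinates,
  extended by the identity.

  That the phases are well defined follows from congruence diagonalisation (existence) and from the
  spectrum of \<open>A\<inverse> A\<^sup>*\<close> (uniqueness).
\<close>

section \<open>Adjoints, quadratic forms and accretive matrices\<close>

lemma adjoint_dim [simp]:
  "dim_row (mat_adjoint A) = dim_col A" "dim_col (mat_adjoint A) = dim_row A"
  unfolding mat_adjoint_def by auto

lemma adjoint_carrier [simp]:
  "A \<in> carrier_mat n m \<Longrightarrow> mat_adjoint A \<in> carrier_mat m n"
  by (intro carrier_matI) auto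

lemma adjoint_index [simp]:
  "i < dim_col A \<Longrightarrow> j < dim_row A \<Longrightarrow> mat_adjoint A $$ (i, j) = conjugate (A $$ (j, i))"
  unfolding mat_adjoint_def by (auto simp: mat_of_rows_def)

lemma adjoint_adjoint [simp]: "mat_adjoint (mat_adjoint A) = A"
  by (intro eq_matI) auto

lemma adjoint_mult:
  assumes "dim_col A = dim_row B"
  shows "mat_adjoint (A * B) = mat_adjoint B * mat_adjoint A"
  using assms
  by (intro eq_matI)
     (auto simp: scalar_prod_def sum_conjugate conjugate_dist_mul mult.commute intro!: sum.cong)

lemma adjoint_mat_diag:
  "mat_adjoint (mat_diag n f) = mat_diag n (\<lambda>i. conjugate (f i))"
  by (intro eq_matI) (auto simp: mat_diag_def)

text \<open>This is \<open>x\<^sup>* A x\<close>, because \<open>\<bullet>c\<close> conjugates its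
  second argument.\<close>

definition qform :: "complex mat \<Rightarrow> complex vec \<Rightarrow> complex" where
  "qform A x = (A *\<^sub>v x) \<bullet>c x"

text \<open>The real part of \<open>qform A x\<close> is the quadratic form of the Hermitian part of
  \<open>A\<close>, so this is strict accretivity expressed without forming that part.\<close>

definition accretive_mat :: "nat \<Rightarrow> complex mat \<Rightarrow> bool" where
  "accretive_mat n A \<longleftrightarrow> A \<in> carrier_mat n n \<and>
     (\<forall>x \<in> carrier_vec n. x \<noteq> 0\<^sub>v n \<longrightarrow> 0 < Re (qform A x))"

lemma qform_sum:
  assumes "A \<in> carrier_mat n n" "x \<in> carrier_vec n"
  shows "qform A x = (\<Sum>i<n. (\<Sum>j<n. A $$ (i, j) * x $ j) * cnj (x $ i))"
  using assms unfolding qform_def by (auto simp: scalar_prod_def atLeast0LessThan)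

lemma adjoint_scalar_prod:
  assumes P: "P \<in> carrier_mat n m" and u: "u \<in> carrier_vec n" and x: "x \<in> carrier_vec m"
  shows "(mat_adjoint P *\<^sub>v u) \<bullet>c x = u \<bullet>c ((P :: complex mat) *\<^sub>v x)"
proof -
  have "(mat_adjoint P *\<^sub>v u) \<bullet>c x = (\<Sum>i<m. (\<Sum>j<n. cnj (P $$ (j, i)) * u $ j) * cnj (x $ i))"
    using assms by (auto simp: scalar_prod_def atLeast0LessThan)
  also have "\<dots> = (\<Sum>i<m. \<Sum>j<n. cnj (P $$ (j, i)) * u $ j * cnj (x $ i))"
    by (simp add: sum_distrib_right)
  also have "\<dots> = (\<Sum>j<n. \<Sum>i<m. cnj (P $$ (j, i)) * u $ j * cnj (x $ i))"
    by (rule sum.swap)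
  also have "\<dots> = (\<Sum>j<n. u $ j * cnj (\<Sum>i<m. P $$ (j, i) * x $ i))"
    by (simp add: sum_distrib_left mult_ac)
  also have "\<dots> = u \<bullet>c (P *\<^sub>v x)"
    using assms by (auto simp: scalar_prod_def atLeast0LessThan)
  finally show ?thesis .
qed

lemma qform_congruence:
  assumes A: "A \<in> carrier_mat n n" and P: "P \<in> carrier_mat n n" and x: "x \<in> carrier_vec n"
  shows "qform (mat_adjoint P * A * P) x = qform A (P *\<^sub>v x)"
proof -
  have Px: "P *\<^sub>v x \<in> carrier_vec n" using P x by auto
  have "(mat_adjoint P * A * P) *\<^sub>v x = mat_adjoint P *\<^sub>v (A *\<^sub>v (P *\<^sub>v x))"
    using assoc_mult_mat_vec[OF mult_carrier_mat[OF adjoint_carrier[OF P] A] P x]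
      assoc_mult_mat_vec[OF adjoint_carrier[OF P] A Px] by simp
  then show ?thesis
    unfolding qform_def using adjoint_scalar_prod[OF P mult_mat_vec_carrier[OF A Px] x] by simp
qed

lemma qform_mat_diag:
  assumes x: "x \<in> carrier_vec n"
  shows "qform (mat_diag n f) x = (\<Sum>i<n. f i * of_real ((cmod (x $ i))\<^sup>2))"
proof -
  have "(\<Sum>j<n. mat_diag n f $$ (i, j) * x $ j) = f i * x $ i" if "i < n" for i
  proof -
    have "(\<Sum>j<n. mat_diag n f $$ (i, j) * x $ j) = (\<Sum>j<n. if i = j then f i * x $ i else 0)"
      using that by (intro sum.cong) (auto simp: mat_diag_def)
    then show ?thesis using that by simp
  qed
  then show ?thesis
    using x by (simp add: qform_sum[OF mat_diag_dim] complex_norm_square mult.assoc flip: of_real_power)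
qed

lemma inverse_mat_vec_nonzero:
  assumes P: "(P :: 'a :: field mat) \<in> carrier_mat n n" and Q: "Q \<in> carrier_mat n n" and QP: "Q * P = 1\<^sub>m n"
    and x: "x \<in> carrier_vec n" "x \<noteq> 0\<^sub>v n"
  shows "P *\<^sub>v x \<noteq> 0\<^sub>v n"
proof
  assume "P *\<^sub>v x = 0\<^sub>v n"
  then have "Q *\<^sub>v (P *\<^sub>v x) = 0\<^sub>v n" using Q by auto
  moreover have "Q *\<^sub>v (P *\<^sub>v x) = x"
    using assoc_mult_mat_vec[OF Q P x(1)] QP x(1) by simp
  ultimately show False using x by simp
qed

lemma accretive_congruence:
  assumes "accretive_mat n A" "P \<in> carrier_mat n n" "Q \<in> carrier_mat n n" "Q * P = 1\<^sub>m n"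
  shows "accretive_mat n (mat_adjoint P * A * P)"
proof -
  have A: "A \<in> carrier_mat n n" using assms(1) unfolding accretive_mat_def by auto
  have "0 < Re (qform (mat_adjoint P * A * P) x)" if x: "x \<in> carrier_vec n" "x \<noteq> 0\<^sub>v n" for x
    unfolding qform_congruence[OF A assms(2) x(1)]
    using assms(1) inverse_mat_vec_nonzero[OF assms(2-4) x] mult_mat_vec_carrier[OF assms(2) x(1)]
    unfolding accretive_mat_def by blast
  then show ?thesis
    using mult_carrier_mat[OF mult_carrier_mat[OF adjoint_carrier[OF assms(2)] A] assms(2)]
    unfolding accretive_mat_def by blast
qed

lemma invertible_mat_obtain:
  assumes "invertible_mat P" "P \<in> carrier_mat n n"
  obtains Q where "Q \<in> carrier_mat n n" "P * Q = 1\<^sub>m n" "Q * P = 1\<^sub>m n"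
proof -
  from assms obtain Q where Q: "P * Q = 1\<^sub>m n" "Q * P = 1\<^sub>m (dim_row Q)"
    unfolding invertible_mat_def inverts_mat_def by auto
  have "dim_col Q = n" using Q(1) by (metis index_mult_mat(3) index_one_mat(3))
  moreover have "dim_row Q = n" using Q(2) assms(2)
    by (metis carrier_matD(2) index_mult_mat(3) index_one_mat(3))
  ultimately show ?thesis using Q that[of Q] by auto
qed

lemma det_nonzero_obtain_inverse:
  assumes P: "(P :: 'a :: field mat) \<in> carrier_mat n n" and d: "det P \<noteq> 0"
  obtains Q where "Q \<in> carrier_mat n n" "P * Q = 1\<^sub>m n" "Q * P = 1\<^sub>m n"
  using det_non_zero_imp_unit[OF P d, of undefined] that
  unfolding Units_def ring_mat_def by auto

lemma det_nonzero_invertible: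
  assumes P: "(P :: 'a :: field mat) \<in> carrier_mat n n" and d: "det P \<noteq> 0"
  shows "invertible_mat P"
proof -
  obtain Q where "Q \<in> carrier_mat n n" "P * Q = 1\<^sub>m n" "Q * P = 1\<^sub>m n"
    using det_nonzero_obtain_inverse[OF P d] .
  then show ?thesis using P unfolding invertible_mat_def inverts_mat_def by auto
qed

text \<open>A nonzero kernel vector would make the quadratic form vanish.\<close>

lemma accretive_det_nonzero:
  assumes "accretive_mat n A"
  shows "det A \<noteq> 0"
proof
  have A: "A \<in> carrier_mat n n" using assms unfolding accretive_mat_def by auto
  assume "det A = 0"
  then obtain x where x: "x \<in> carrier_vec n" "x \<noteq> 0\<^sub>v n" "A *\<^sub>v x = 0\<^sub>v n"
    using det_0_iff_vec_prod_zero_field[OF A] by auto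
  have "qform A x = 0" unfolding qform_def x(3) using x(1) by (auto simp: scalar_prod_def)
  then show False using assms x unfolding accretive_mat_def by force
qed

section \<open>Uniqueness of the phases\<close>

lemma mset_eq_if_linear_factors_eq:
  fixes as bs :: "'a :: idom list"
  assumes "(\<Prod>a\<leftarrow>as. [:- a, 1:]) = (\<Prod>a\<leftarrow>bs. [:- a, 1:])"
  shows "mset as = mset bs"
proof -
  have "proots (\<Prod>a\<leftarrow>as. [:- a, 1:]) = mset as" for as :: "'a list"
  proof (induction as)
    case (Cons a as)
    have "(\<Prod>a\<leftarrow>as. [:- a, 1:]) \<noteq> 0" by (auto simp: prod_list_zero_iff)
    then show ?case using Cons by (simp add: proots_mult del: mult_pCons_left mult_pCons_right)
  qed simp
  then show ?thesis using assms by metis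
qed

text \<open>The matrix \<open>A\<inverse> A\<^sup>*\<close> is similar to \<open>diag(e\<^sup>-\<^sup>2\<^sup>i\<^sup>\<phi>)\<close>, so its spectrum determines the phases.\<close>

lemma char_poly_phases:
  assumes A: "A \<in> carrier_mat n n" and ph: "is_phase_list A ps"
    and B: "B \<in> carrier_mat n n" "B * A = 1\<^sub>m n"
  shows "char_poly (B * mat_adjoint A) = (\<Prod>p\<leftarrow>map (\<lambda>p. cis (- 2 * p)) ps. [:- p, 1:])"
proof -
  define D where "D = mat_diag n (\<lambda>k. cis (ps ! k))"
  define D' where "D' = mat_diag n (\<lambda>k. cis (- (ps ! k)))"
  define E where "E = mat_diag n (\<lambda>k. cis (- 2 * (ps ! k)))"
  from ph A obtain T where len: "length ps = n" and T: "T \<in> carrier_mat n n" "invertible_mat T"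
      "A = mat_adjoint T * D * T"
    unfolding is_phase_list_def D_def by auto
  have DD: "D \<in> carrier_mat n n" "D' \<in> carrier_mat n n" "E \<in> carrier_mat n n"
    unfolding D_def D'_def E_def by auto
  have D2: "D' * D' = E" unfolding E_def D'_def by (simp add: cis_mult)
  obtain S where S: "S \<in> carrier_mat n n" "T * S = 1\<^sub>m n" "S * T = 1\<^sub>m n"
    using invertible_mat_obtain[OF T(2,1)] .
  let ?T = "mat_adjoint T"
  have aT: "?T \<in> carrier_mat n n" using T(1) by auto
  note assoc = assoc_mult_mat[of _ n n _ n _ n] mult_carrier_mat[of _ n n _ n]
  have "mat_adjoint D = D'" unfolding D_def D'_def adjoint_mat_diag by (simp add: cis_cnj)
  then have adA: "mat_adjoint A = ?T * (D' * T)"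
    unfolding T(3) using aT DD T(1) by (simp add: adjoint_mult)
  have D3: "D * D' = 1\<^sub>m n" unfolding D_def D'_def by (simp add: cis_mult)
  have c: "D * T \<in> carrier_mat n n" "S * D' \<in> carrier_mat n n" "B * ?T \<in> carrier_mat n n"
    using DD T(1) S(1) B(1) aT by auto
  have "T * (S * D') = D'"
    using S T(1) DD assoc_mult_mat[OF T(1) S(1) DD(2), symmetric] by simp
  then have inv: "D * T * (S * D') = 1\<^sub>m n"
    using D3 assoc_mult_mat[OF DD(1) T(1) c(2)] by simp
  \<comment> \<open>From \<open>B * A = 1\<close> the factor \<open>B * ?T\<close> is a left inverse
    of \<open>D * T\<close>, hence equals the known inverse \<open>S * D'\<close>. No inverse of the
    adjoint of \<open>T\<close> has to be introduced.\<close>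
  have "B * ?T * (D * T) = B * (?T * (D * T))" by (rule assoc_mult_mat[OF B(1) aT c(1)])
  also have "?T * (D * T) = A" unfolding T(3) by (rule assoc_mult_mat[OF aT DD(1) T(1), symmetric])
  finally have "B * ?T * (D * T) * (S * D') = S * D'"
    using B(2) left_mult_one_mat[OF c(2)] by simp
  then have BTD: "B * ?T = S * D'"
    unfolding assoc_mult_mat[OF c(3,1,2)] inv using right_mult_one_mat[OF c(3)] by simp
  have "B * mat_adjoint A = B * ?T * (D' * T)"
    unfolding adA using B aT DD T(1) by (simp add: assoc)
  also have "\<dots> = S * (D' * D') * T"
    unfolding BTD using S DD T(1) by (simp add: assoc)
  also have "\<dots> = S * E * T" unfolding D2 ..
  finally have "similar_mat (B * mat_adjoint A) E"
    using similar_matI[of "B * mat_adjoint A" E S T n] S T DD B A by auto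
  then have "char_poly (B * mat_adjoint A) = char_poly E" by (rule char_poly_similar)
  also have "upper_triangular E" unfolding E_def mat_diag_def by auto
  from char_poly_upper_triangular[OF DD(3) this]
  have "char_poly E = (\<Prod>a\<leftarrow>diag_mat E. [:- a, 1:])" .
  also have "diag_mat E = map (\<lambda>p. cis (- 2 * p)) ps"
    using len by (intro nth_equalityI) (auto simp: diag_mat_def E_def mat_diag_def)
  finally show ?thesis .
qed

text \<open>Both lists give the same characteristic polynomial, hence the same multiset of numbers
  \<open>cis (- 2 * p)\<close>. As -2p lies in (-pi, pi), the principal argument recovers p, and the
  descending order then fixes the list.\<close>

lemma is_phase_list_unique:
  assumes acc: "accretive_mat n A" and ps: "is_phase_list A ps" and qs: "is_phase_list A qs"
  shows "ps = qs"
proof -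
  have A: "A \<in> carrier_mat n n" using acc unfolding accretive_mat_def by auto
  obtain B where B: "B \<in> carrier_mat n n" "B * A = 1\<^sub>m n"
    using det_nonzero_obtain_inverse[OF A accretive_det_nonzero[OF acc]] by metis
  let ?f = "\<lambda>p. cis (- 2 * p)"
  have "mset (map ?f ps) = mset (map ?f qs)"
    by (rule mset_eq_if_linear_factors_eq) (metis char_poly_phases[OF A _ B] ps qs)
  then have im: "image_mset ?f (mset ps) = image_mset ?f (mset qs)" by simp
  have rng: "set ps \<subseteq> {- pi / 2 <..< pi / 2}" "set qs \<subseteq> {- pi / 2 <..< pi / 2}"
    and srt: "sorted_wrt (\<ge>) ps" "sorted_wrt (\<ge>) qs"
    using ps qs unfolding is_phase_list_def by auto
  have inv: "- Arg (?f p) / 2 = p" if "p \<in> {- pi / 2 <..< pi / 2}" for p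
  proof -
    have "Arg (?f p) = - 2 * p"
      using that by (intro cis_Arg_unique) (auto simp: sgn_cis)
    then show ?thesis by simp
  qed
  have "image_mset (\<lambda>z. - Arg z / 2) (image_mset ?f (mset xs)) = mset xs"
    if "set xs \<subseteq> {- pi / 2 <..< pi / 2}" for xs
  proof -
    have "image_mset (\<lambda>z. - Arg z / 2) (image_mset ?f (mset xs)) = image_mset (\<lambda>p. p) (mset xs)"
      unfolding image_mset.compositionality o_def
      using that by (intro image_mset_cong inv) auto
    then show ?thesis by simp
  qed
  then have "mset ps = mset qs" using im rng by metis
  then have "mset (rev ps) = mset (rev qs)" by simp
  moreover have "sorted (rev ps)" "sorted (rev qs)" using srt by (simp_all add: sorted_wrt_rev)
  ultimately have "rev ps = rev qs" by (metis properties_for_sort)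
  then show ?thesis by simp
qed

section \<open>Existence of the phases by congruence diagonalisation\<close>

lemma qform_adjoint:
  assumes A: "A \<in> carrier_mat n n" and x: "x \<in> carrier_vec n"
  shows "qform (mat_adjoint A) x = cnj (qform A x)"
  using A x unfolding qform_def adjoint_scalar_prod[OF A x x]
  by (auto simp: scalar_prod_def mult.commute)

lemma accretive_adjoint:
  assumes "accretive_mat n A"
  shows "accretive_mat n (mat_adjoint A)"
  using assms qform_adjoint unfolding accretive_mat_def by auto

text \<open>The entrywise form turns bordering \<open>T\<close> by a row, or permuting its rows,
  into an operation on a sum.\<close>

lemma congruence_diag_index:
  assumes T: "(T :: complex mat) \<in> carrier_mat n n" and ij: "i < n" "j < n"
  shows "(mat_adjoint T * mat_diag n d * T) $$ (i, j) = (\<Sum>k<n. cnj (T $$ (k, i)) * d k * T $$ (k, j))"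
  using assms
  by (subst mat_diag_mult_right[OF adjoint_carrier[OF T]]) (auto simp: scalar_prod_def atLeast0LessThan)

lemma Arg_half_plane:
  assumes "0 < Re z"
  shows "Arg z \<in> {- pi / 2 <..< pi / 2}"
proof -
  have z: "z \<noteq> 0" using assms by auto
  have "Re z = cmod z * cos (Arg z)" by (metis Re_rcis rcis_cmod_Arg)
  then have c: "0 < cos (Arg z)" using assms z by (simp add: zero_less_mult_iff)
  have b: "- pi < Arg z" "Arg z \<le> pi" using Arg_bounded by auto
  have "Arg z < pi / 2"
    using b c sin_ge_zero[of "Arg z - pi / 2"] by (fastforce simp: sin_diff)
  moreover have "- Arg z < pi / 2"
    using b c sin_ge_zero[of "- Arg z - pi / 2"] by (fastforce simp: sin_diff)
  ultimately show ?thesis by simp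
qed

text \<open>An eigenvector \<open>x\<close> of \<open>(A\<^sup>*)\<inverse> A\<close> satisfies \<open>A x = u A\<^sup>* x\<close>. In a basis starting with \<open>x\<close>
  the first column of \<open>A\<close> is therefore \<open>u\<close> times the conjugate of the first row, so that a single
  congruence clears both and leaves the Schur complement.\<close>

lemma accretive_diagonalization:
  assumes "accretive_mat n A"
  shows "\<exists>T \<in> carrier_mat n n. \<exists>f. (\<forall>k<n. f k \<in> {- pi / 2 <..< pi / 2}) \<and>
           A = mat_adjoint T * mat_diag n (\<lambda>k. cis (f k)) * T"
  using assms
proof (induction n arbitrary: A)
  case 0
  then have "A \<in> carrier_mat 0 0" unfolding accretive_mat_def by auto
  then have "A = mat_adjoint A * mat_diag 0 (\<lambda>k. cis 0) * A" by (intro eq_matI) auto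
  then show ?case
    using \<open>A \<in> carrier_mat 0 0\<close> by (intro bexI[of _ A] exI[of _ "\<lambda>_. 0"]) simp_all
next
  case (Suc n)
  let ?N = "Suc n"
  let ?A = "mat_adjoint A"
  have A: "A \<in> carrier_mat ?N ?N" using Suc.prems unfolding accretive_mat_def by auto
  have aA: "?A \<in> carrier_mat ?N ?N" using A by simp
  obtain B where B: "B \<in> carrier_mat ?N ?N" "?A * B = 1\<^sub>m ?N" 
    using det_nonzero_obtain_inverse[OF aA accretive_det_nonzero[OF accretive_adjoint[OF Suc.prems]]]
    by metis
  have BA: "B * A \<in> carrier_mat ?N ?N" using A B by auto
  obtain es where es: "char_poly (B * A) = (\<Prod>e\<leftarrow>es. [:- e, 1:])"
    using char_poly_factorized[OF BA] by auto
  \<comment> \<open>The first column of the triangular \<open>U\<close> vanishes below the diagonal,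
    so the first column of \<open>P\<close> is an eigenvector of \<open>B * A\<close>, where
    \<open>B\<close> is the inverse of the adjoint of \<open>A\<close>.\<close>
  obtain U P Q where "schur_decomposition (B * A) es = (U, P, Q)" by (metis prod_cases3)
  from schur_decomposition[OF BA es this]
  have wit: "similar_mat_wit (B * A) U P Q" and ut: "upper_triangular U" by auto
  from similar_mat_witD2[OF BA wit]
  have PQ: "P * Q = 1\<^sub>m ?N" "Q * P = 1\<^sub>m ?N" "B * A = P * U * Q"
    and c: "U \<in> carrier_mat ?N ?N" "P \<in> carrier_mat ?N ?N" "Q \<in> carrier_mat ?N ?N" by auto
  define A' where "A' = mat_adjoint P * A * P"
  have aP: "mat_adjoint P \<in> carrier_mat ?N ?N" using c by simp
  have A': "A' \<in> carrier_mat ?N ?N" unfolding A'_def using A aP c by auto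
  have aA': "mat_adjoint A' \<in> carrier_mat ?N ?N" using A' by simp
  have acc': "accretive_mat ?N A'" unfolding A'_def by (rule accretive_congruence[OF Suc.prems c(2,3) PQ(2)])
  have "B * A * P = P * U * (Q * P)"
    unfolding PQ(3) by (rule assoc_mult_mat) (use c in auto)
  then have BAP: "B * A * P = P * U" using PQ(2) c by simp
  have "A * P = ?A * B * (A * P)" using B(2) A c left_mult_one_mat[of "A * P" ?N ?N] by simp
  also have "\<dots> = ?A * (B * (A * P))" by (rule assoc_mult_mat) (use A aA B c in auto)
  also have "B * (A * P) = P * U" unfolding BAP[symmetric] by (rule assoc_mult_mat[symmetric]) (use A B c in auto)
  finally have AP: "A * P = ?A * (P * U)" .
  have "A' = mat_adjoint P * (A * P)" unfolding A'_def by (rule assoc_mult_mat[OF aP A c(2)])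
  also have "\<dots> = mat_adjoint P * (?A * P * U)"
    unfolding AP by (subst assoc_mult_mat[OF aA c(2,1)]) simp
  also have "\<dots> = mat_adjoint P * (?A * P) * U"
    by (rule assoc_mult_mat[symmetric]) (use aP aA c in auto)
  also have "mat_adjoint P * (?A * P) = mat_adjoint A'"
  proof -
    have "mat_adjoint A' = mat_adjoint P * mat_adjoint (mat_adjoint P * A)"
      unfolding A'_def using A c by (subst adjoint_mult) auto
    also have "mat_adjoint (mat_adjoint P * A) = ?A * P"
      using A c by (subst adjoint_mult) auto
    finally show ?thesis by simp
  qed
  \<comment> \<open>The identity \<open>A = ?A * (B * A)\<close> transported to the basis given by
    \<open>P\<close>.\<close>
  finally have A'U: "A' = mat_adjoint A' * U" .
  define a where "a = A' $$ (0, 0)"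
  define m where "m = (\<lambda>j. A' $$ (0, j) / a)"
  \<comment> \<open>The pivot \<open>a\<close> is itself a value of the form, so its real part is
    positive: it can be divided by, and its argument is an admissible phase.\<close>
  have "qform A' (unit_vec ?N 0) = a"
    using A' by (simp add: qform_sum[OF A'] unit_vec_def a_def sum.lessThan_Suc_shift del: sum.lessThan_Suc)
  moreover have "unit_vec ?N 0 \<noteq> (0\<^sub>v ?N :: complex vec)" by simp
  ultimately have Rea: "0 < Re a" using acc' unfolding accretive_mat_def by fastforce
  then have a0: "a \<noteq> 0" by auto
  have col0: "A' $$ (i, 0) = cnj (A' $$ (0, i)) * U $$ (0, 0)" if i: "i < ?N" for i
  proof -
    have "A' $$ (i, 0) = (mat_adjoint A' * U) $$ (i, 0)" using A'U by simp
    also have "\<dots> = (\<Sum>k<?N. cnj (A' $$ (k, i)) * U $$ (k, 0))"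
      using i A' aA' c(1) by (simp add: scalar_prod_def atLeast0LessThan del: sum.lessThan_Suc)
    also have "\<dots> = cnj (A' $$ (0, i)) * U $$ (0, 0)"
      unfolding sum.lessThan_Suc_shift using c(1) ut by (simp add: upper_triangular_def)
    finally show ?thesis .
  qed
  have "a = cnj a * U $$ (0, 0)" using col0[of 0] unfolding a_def by simp
  then have U0: "U $$ (0, 0) = a / cnj a" using a0 by (simp add: field_simps)
  \<comment> \<open>Row 0 is \<open>a * m j\<close> by definition. Column 0 being
    \<open>a * cnj (m i)\<close>, one rank-one term \<open>a * cnj (m i) * m j\<close> accounts for
    both.\<close>
  have cm: "A' $$ (i, 0) = a * cnj (m i)" if "i < ?N" for i
    using col0[OF that] a0 unfolding U0 m_def by (simp add: field_simps)
  define D where "D = mat n n (\<lambda>(i, j). A' $$ (Suc i, Suc j) - A' $$ (Suc i, 0) * m (Suc j))"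
  have D: "D \<in> carrier_mat n n" unfolding D_def by auto
  have "accretive_mat n D"
    unfolding accretive_mat_def
  proof (intro conjI D ballI impI)
    fix y :: "complex vec" assume y: "y \<in> carrier_vec n" "y \<noteq> 0\<^sub>v n"
    \<comment> \<open>The extra entry is chosen to make entry 0 of \<open>A' x\<close> vanish. The
      form of \<open>A'\<close> at \<open>x\<close> is then that of the Schur complement
      \<open>D\<close> at \<open>y\<close>, which inherits accretivity.\<close>
    define x where "x = vec ?N (case_nat (- (\<Sum>j<n. m (Suc j) * y $ j)) (\<lambda>i. y $ i))"
    have x: "x \<in> carrier_vec ?N" unfolding x_def by auto
    have x0: "x $ 0 = - (\<Sum>j<n. m (Suc j) * y $ j)" and xS: "\<And>i. i < n \<Longrightarrow> x $ Suc i = y $ i"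
      unfolding x_def by auto
    have "x \<noteq> 0\<^sub>v ?N"
    proof
      assume "x = 0\<^sub>v ?N"
      then have "y $ i = 0" if "i < n" for i using xS[OF that] that by simp
      then have "y = 0\<^sub>v n" using y(1) by (intro eq_vecI) auto
      then show False using y(2) by simp
    qed
    then have "0 < Re (qform A' x)" using acc' x unfolding accretive_mat_def by blast
    also have "qform A' x = qform D y"
    proof -
      have "(\<Sum>j<?N. A' $$ (0, j) * x $ j) = a * x $ 0 + (\<Sum>j<n. a * m (Suc j) * y $ j)"
        using a0 xS by (simp add: sum.lessThan_Suc_shift a_def m_def del: sum.lessThan_Suc)
      also have "\<dots> = 0" unfolding x0 by (simp add: sum_distrib_left mult.assoc)
      finally have r0: "(\<Sum>j<?N. A' $$ (0, j) * x $ j) = 0" .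
      have rS: "(\<Sum>j<?N. A' $$ (Suc i, j) * x $ j) = (\<Sum>j<n. D $$ (i, j) * y $ j)" if i: "i < n" for i
      proof -
        have "(\<Sum>j<?N. A' $$ (Suc i, j) * x $ j)
            = A' $$ (Suc i, 0) * x $ 0 + (\<Sum>j<n. A' $$ (Suc i, Suc j) * y $ j)"
          using xS by (simp add: sum.lessThan_Suc_shift del: sum.lessThan_Suc)
        also have "\<dots> = (\<Sum>j<n. D $$ (i, j) * y $ j)"
          using i unfolding x0 D_def
          by (simp add: sum_distrib_left algebra_simps sum_subtractf)
        finally show ?thesis .
      qed
      show ?thesis
        unfolding qform_sum[OF A' x] qform_sum[OF D y(1)]
        by (subst sum.lessThan_Suc_shift) (simp add: r0 rS xS del: sum.lessThan_Suc)
    qed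
    finally show "0 < Re (qform D y)" .
  qed
  from Suc.IH[OF this] obtain T f where T: "T \<in> carrier_mat n n"
    and f: "\<forall>k<n. f k \<in> {- pi / 2 <..< pi / 2}"
    and DT: "D = mat_adjoint T * mat_diag n (\<lambda>k. cis (f k)) * T" by auto
  define g where "g = case_nat (Arg a) f"
  define d where "d = (\<lambda>k. cis (g k))"
  \<comment> \<open>Row 0 contributes \<open>a * cnj (m i) * m j\<close>, with the modulus of
    \<open>a\<close> split into two square roots and its argument kept as the phase. The other rows
    border \<open>T\<close> by a zero column and contribute \<open>D\<close>.\<close>
  define T' where "T' = mat ?N ?N (\<lambda>(k, j). case k of 0 \<Rightarrow> of_real (sqrt (cmod a)) * m j
       | Suc k' \<Rightarrow> (case j of 0 \<Rightarrow> 0 | Suc j' \<Rightarrow> T $$ (k', j')))"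
  have T': "T' \<in> carrier_mat ?N ?N" unfolding T'_def by auto
  have g: "\<forall>k<?N. g k \<in> {- pi / 2 <..< pi / 2}"
    using f Arg_half_plane[OF Rea] unfolding g_def by (auto split: nat.split)
  have root: "of_real (sqrt (cmod a)) * cis (Arg a) * of_real (sqrt (cmod a)) = a"
  proof -
    have "of_real (sqrt (cmod a)) * cis (Arg a) * of_real (sqrt (cmod a))
        = of_real (sqrt (cmod a) * sqrt (cmod a)) * cis (Arg a)"
      unfolding of_real_mult by (simp only: mult_ac)
    also have "\<dots> = a" using rcis_cmod_Arg[of a] by (simp add: rcis_def)
    finally show ?thesis .
  qed
  have first: "cnj (of_real (sqrt (cmod a)) * m i) * cis (Arg a) * (of_real (sqrt (cmod a)) * m j)
      = a * cnj (m i) * m j" for i j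
    by (subst (3) root[symmetric]) simp
  have A'T': "A' = mat_adjoint T' * mat_diag ?N d * T'"
  proof (rule eq_matI)
    show "dim_row A' = dim_row (mat_adjoint T' * mat_diag ?N d * T')"
      "dim_col A' = dim_col (mat_adjoint T' * mat_diag ?N d * T')" using A' T' by auto
    fix i j assume "i < dim_row (mat_adjoint T' * mat_diag ?N d * T')"
      "j < dim_col (mat_adjoint T' * mat_diag ?N d * T')"
    then have ij: "i < ?N" "j < ?N" using T' by auto
    have "(mat_adjoint T' * mat_diag ?N d * T') $$ (i, j)
       = a * cnj (m i) * m j + (\<Sum>k<n. cnj (T' $$ (Suc k, i)) * d (Suc k) * T' $$ (Suc k, j))"
      unfolding congruence_diag_index[OF T' ij] sum.lessThan_Suc_shift first[symmetric]
      using ij by (simp add: T'_def d_def g_def)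
    also have "(\<Sum>k<n. cnj (T' $$ (Suc k, i)) * d (Suc k) * T' $$ (Suc k, j))
       = A' $$ (i, j) - a * cnj (m i) * m j"
    proof (cases "i = 0 \<or> j = 0")
      case True
      have "m 0 = 1" using a0 by (simp add: m_def a_def)
      then have "A' $$ (i, j) = a * cnj (m i) * m j"
        using True cm[OF ij(1)] a0 by (auto simp: m_def)
      then show ?thesis using True ij by (auto simp: T'_def)
    next
      case False
      then obtain i' j' where s: "i = Suc i'" "j = Suc j'" by (metis not0_implies_Suc)
      have "(\<Sum>k<n. cnj (T' $$ (Suc k, i)) * d (Suc k) * T' $$ (Suc k, j)) = D $$ (i', j')"
        using ij s unfolding DT by (subst congruence_diag_index[OF T]) (auto simp: T'_def d_def g_def)
      also have "\<dots> = A' $$ (i, j) - a * cnj (m i) * m j"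
        using ij s cm[of i] by (simp add: D_def)
      finally show ?thesis .
    qed
    finally show "A' $$ (i, j) = (mat_adjoint T' * mat_diag ?N d * T') $$ (i, j)" by simp
  qed
  have dd: "mat_diag ?N d \<in> carrier_mat ?N ?N" by simp
  have aT': "mat_adjoint T' \<in> carrier_mat ?N ?N" and aQ: "mat_adjoint Q \<in> carrier_mat ?N ?N"
    using T' c by auto
  have PQ': "mat_adjoint Q * mat_adjoint P = 1\<^sub>m ?N"
  proof -
    have "mat_adjoint Q * mat_adjoint P = mat_adjoint (P * Q)" using c by (simp add: adjoint_mult)
    also have "\<dots> = 1\<^sub>m ?N" unfolding PQ(1) by (intro eq_matI) auto
    finally show ?thesis .
  qed
  have QA: "A = mat_adjoint Q * A' * Q"
  proof -
    have "mat_adjoint Q * A' * Q = mat_adjoint Q * (mat_adjoint P * (A * P)) * Q"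
      unfolding A'_def using assoc_mult_mat[OF aP A c(2)] by simp
    also have "\<dots> = mat_adjoint Q * mat_adjoint P * (A * P) * Q"
      using assoc_mult_mat[OF aQ aP mult_carrier_mat[OF A c(2)]] by simp
    also have "\<dots> = A * P * Q" using PQ' A c left_mult_one_mat[of "A * P" ?N ?N] by simp
    also have "\<dots> = A" using assoc_mult_mat[OF A c(2,3)] PQ(1) A by simp
    finally show ?thesis by simp
  qed
  have "A = mat_adjoint (T' * Q) * mat_diag ?N d * (T' * Q)"
  proof -
    have "mat_adjoint Q * A' * Q = mat_adjoint Q * (mat_adjoint T' * mat_diag ?N d) * T' * Q"
      using assoc_mult_mat[OF aQ mult_carrier_mat[OF aT' dd] T'] A'T' by simp
    also have "\<dots> = mat_adjoint Q * (mat_adjoint T' * mat_diag ?N d) * (T' * Q)"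
      by (rule assoc_mult_mat[OF mult_carrier_mat[OF aQ mult_carrier_mat[OF aT' dd]] T' c(3)])
    also have "mat_adjoint Q * (mat_adjoint T' * mat_diag ?N d) = mat_adjoint (T' * Q) * mat_diag ?N d"
      using assoc_mult_mat[OF aQ aT' dd] T' c by (simp add: adjoint_mult)
    finally show ?thesis using QA by simp
  qed
  moreover have "T' * Q \<in> carrier_mat ?N ?N" using T' c by auto
  ultimately show ?case using g unfolding d_def by blast
qed

text \<open>The phases from the diagonalisation come in no particular order; sorting them is
  compensated by permuting the rows of the transforming matrix.\<close>

lemma is_phase_list_exists:
  assumes acc: "accretive_mat n A"
  shows "\<exists>ps. is_phase_list A ps"
proof -
  have A: "A \<in> carrier_mat n n" using acc unfolding accretive_mat_def by auto
  from accretive_diagonalization[OF acc] obtain T f where T: "T \<in> carrier_mat n n"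
    and f: "\<forall>k<n. f k \<in> {- pi / 2 <..< pi / 2}"
    and AT: "A = mat_adjoint T * mat_diag n (\<lambda>k. cis (f k)) * T" by auto
  define ps where "ps = rev (sort (map f [0..<n]))"
  have "mset ps = mset (map f [0..<n])" unfolding ps_def by simp
  then obtain p where p: "p permutes {..<length (map f [0..<n])}" "permute_list p (map f [0..<n]) = ps"
    using mset_eq_permutation by blast
  then have pn: "p permutes {..<n}" by simp
  have psk: "ps ! k = f (p k)" if "k < n" for k
  proof -
    have "p k < n" using permutes_in_image[OF pn, of k] that by simp
    then show ?thesis
      unfolding p(2)[symmetric] using that by (subst permute_list_nth[OF p(1)]) auto
  qed
  define S where "S = mat n n (\<lambda>(k, j). T $$ (p k, j))"
  have S: "S \<in> carrier_mat n n" unfolding S_def by auto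
  have AS: "A = mat_adjoint S * mat_diag n (\<lambda>k. cis (ps ! k)) * S"
  proof (rule eq_matI)
    show "dim_row A = dim_row (mat_adjoint S * mat_diag n (\<lambda>k. cis (ps ! k)) * S)"
      "dim_col A = dim_col (mat_adjoint S * mat_diag n (\<lambda>k. cis (ps ! k)) * S)" using A S by auto
    fix i j assume "i < dim_row (mat_adjoint S * mat_diag n (\<lambda>k. cis (ps ! k)) * S)"
      "j < dim_col (mat_adjoint S * mat_diag n (\<lambda>k. cis (ps ! k)) * S)"
    then have ij: "i < n" "j < n" using S by auto
    have "(\<Sum>k<n. cnj (S $$ (k, i)) * cis (ps ! k) * S $$ (k, j))
        = (\<Sum>k<n. cnj (T $$ (p k, i)) * cis (f (p k)) * T $$ (p k, j))"
      using ij psk unfolding S_def by (intro sum.cong) auto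
    also have "\<dots> = (\<Sum>k<n. cnj (T $$ (k, i)) * cis (f k) * T $$ (k, j))"
      by (rule sum.reindex_bij_betw[OF permutes_imp_bij[OF pn]])
    finally show "A $$ (i, j) = (mat_adjoint S * mat_diag n (\<lambda>k. cis (ps ! k)) * S) $$ (i, j)"
      unfolding congruence_diag_index[OF S ij] using congruence_diag_index[OF T ij] AT by simp
  qed
  \<comment> \<open>Invertibility of \<open>S\<close> is read off from the nonzero determinant of
    \<open>A\<close>.\<close>
  have "det A = det (mat_adjoint S * mat_diag n (\<lambda>k. cis (ps ! k))) * det S"
    by (subst AS, intro det_mult[OF _ S] mult_carrier_mat[OF adjoint_carrier[OF S]]) simp
  then have "invertible_mat S"
    using accretive_det_nonzero[OF acc] det_nonzero_invertible[OF S] by auto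
  moreover have "length ps = n" "sorted_wrt (\<ge>) ps" "set ps \<subseteq> {- pi / 2 <..< pi / 2}"
    using f unfolding ps_def by (auto simp: sorted_wrt_rev)
  ultimately have "is_phase_list A ps"
    unfolding is_phase_list_def using A S AS by auto
  then show ?thesis ..
qed

section \<open>Extremal characterisation of the largest phase\<close>

lemma is_phase_list_phases:
  assumes "accretive_mat n A"
  shows "is_phase_list A (phases A)"
  unfolding phases_def
  using is_phase_list_exists[OF assms] is_phase_list_unique[OF assms] by (metis theI')

text \<open>In the coordinates \<open>T x\<close> the form is a combination of the
  \<open>cis\<close> of the phases with nonnegative weights. Rotating by the largest phase puts
  every term into the closed lower half plane. Stating the bound by an imaginary part avoids the
  argument of a form value that may be 0.\<close>

lemma largest_phase_extremal:
  assumes acc: "accretive_mat n A" and n: "0 < n"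
  defines "\<theta> \<equiv> largest_phase A"
  shows "- pi / 2 < \<theta>" "\<theta> < pi / 2"
    "x \<in> carrier_vec n \<Longrightarrow> Im (cis (- \<theta>) * qform A x) \<le> 0"
    "\<exists>x \<in> carrier_vec n. qform A x = cis \<theta>"
proof -
  have A: "A \<in> carrier_mat n n" using acc unfolding accretive_mat_def by auto
  define ps where "ps = phases A"
  have "is_phase_list A ps" unfolding ps_def by (rule is_phase_list_phases[OF acc])
  then obtain T where ps: "length ps = n" "sorted_wrt (\<ge>) ps" "set ps \<subseteq> {- pi / 2 <..< pi / 2}"
    and T: "T \<in> carrier_mat n n" "invertible_mat T"
    and AT: "A = mat_adjoint T * mat_diag n (\<lambda>k. cis (ps ! k)) * T"
    unfolding is_phase_list_def using A by auto
  have th: "\<theta> = ps ! 0" unfolding \<theta>_def largest_phase_def ps_def ..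
  have rng: "- pi / 2 < ps ! k \<and> ps ! k < pi / 2" if "k < n" for k
    using ps(1,3) that nth_mem[of k ps] greaterThanLessThan_iff by blast
  show th1: "- pi / 2 < \<theta>" and th2: "\<theta> < pi / 2" using rng[OF n] unfolding th by auto
  have qT: "qform A x = (\<Sum>k<n. cis (ps ! k) * of_real ((cmod ((T *\<^sub>v x) $ k))\<^sup>2))"
    if x: "x \<in> carrier_vec n" for x
  proof -
    have "qform A x = qform (mat_diag n (\<lambda>k. cis (ps ! k))) (T *\<^sub>v x)"
      by (subst AT) (rule qform_congruence[OF mat_diag_dim T(1) x])
    then show ?thesis using qform_mat_diag[of "T *\<^sub>v x" n] T(1) x by simp
  qed
  show "Im (cis (- \<theta>) * qform A x) \<le> 0" if x: "x \<in> carrier_vec n"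
  proof -
    have "Im (cis (- \<theta>) * qform A x) = (\<Sum>k<n. sin (ps ! k - \<theta>) * (cmod ((T *\<^sub>v x) $ k))\<^sup>2)"
      unfolding qT[OF x] sum_distrib_left Im_sum
      by (intro sum.cong) (simp_all add: mult.assoc[symmetric] cis_mult del: of_real_power)
    also have "\<dots> \<le> 0"
    proof (rule sum_nonpos)
      fix k assume "k \<in> {..<n}"
      then have k: "k < n" by simp
      have "ps ! k \<le> \<theta>"
        unfolding th using sorted_wrt_nth_less[OF ps(2), of 0 k] ps(1) k by (cases "k = 0") auto
      then have "0 \<le> sin (\<theta> - ps ! k)"
        using rng[OF k] th2 by (intro sin_ge_zero) auto
      then have "sin (ps ! k - \<theta>) \<le> 0" using sin_minus[of "\<theta> - ps ! k"] by simp
      then show "sin (ps ! k - \<theta>) * (cmod ((T *\<^sub>v x) $ k))\<^sup>2 \<le> 0"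
        by (simp add: mult_nonpos_nonneg)
    qed
    finally show ?thesis .
  qed
  obtain S where S: "S \<in> carrier_mat n n" "T * S = 1\<^sub>m n" "S * T = 1\<^sub>m n"
    using invertible_mat_obtain[OF T(2,1)] .
  \<comment> \<open>The preimage of the first unit vector under \<open>T\<close> isolates the
    largest phase.\<close>
  define x where "x = S *\<^sub>v unit_vec n 0"
  have x: "x \<in> carrier_vec n" unfolding x_def using S by auto
  have "T *\<^sub>v x = unit_vec n 0"
    unfolding x_def using assoc_mult_mat_vec[OF T(1) S(1) unit_vec_carrier[of n 0]] S(2) by simp
  then have "qform A x = (\<Sum>k<n. if k = 0 then cis \<theta> else 0)"
    unfolding qT[OF x] th by (intro sum.cong) (auto simp: unit_vec_def)
  also have "\<dots> = cis \<theta>" using n by simp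
  finally show "\<exists>x \<in> carrier_vec n. qform A x = cis \<theta>" using x by blast
qed

section \<open>Real matrices acting on complex vectors\<close>

lemma mat_adjoint_real: "mat_adjoint (A :: real mat) = transpose_mat A"
  by (intro eq_matI) auto

lemma conjugate_vec_real: "conjugate (v :: real vec) = v"
  by (intro eq_vecI) auto

text \<open>A real matrix and its transpose have the same quadratic form. The factor
  \<open>c\<close> covers both \<Delta> + \<Delta>^T and its half, the Hermitian part.\<close>

lemma pos_def_mat_symmetric_part:
  assumes D: "(\<Delta> :: real mat) \<in> carrier_mat n n" and c: "0 < c"
  shows "pos_def_mat (c \<cdot>\<^sub>m (\<Delta> + transpose_mat \<Delta>)) \<longleftrightarrow>
    (\<forall>u \<in> carrier_vec n. u \<noteq> 0\<^sub>v n \<longrightarrow> 0 < (\<Delta> *\<^sub>v u) \<bullet> u)"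
proof -
  let ?S = "c \<cdot>\<^sub>m (\<Delta> + transpose_mat \<Delta>)"
  have S: "?S \<in> carrier_mat n n" using D by auto
  have "(?S *\<^sub>v u) \<bullet> u = 2 * c * ((\<Delta> *\<^sub>v u) \<bullet> u)" if u: "u \<in> carrier_vec n" for u
  proof -
    have Du: "\<Delta> *\<^sub>v u \<in> carrier_vec n" "transpose_mat \<Delta> *\<^sub>v u \<in> carrier_vec n" using D u by auto
    have "(transpose_mat \<Delta> *\<^sub>v u) \<bullet> u = u \<bullet> (\<Delta> *\<^sub>v u)"
      by (rule transpose_vec_mult_scalar[OF D u u])
    also have "\<dots> = (\<Delta> *\<^sub>v u) \<bullet> u" by (rule comm_scalar_prod[OF u Du(1)])
    finally have t: "(transpose_mat \<Delta> *\<^sub>v u) \<bullet> u = (\<Delta> *\<^sub>v u) \<bullet> u" .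
    have "?S *\<^sub>v u = c \<cdot>\<^sub>v ((\<Delta> + transpose_mat \<Delta>) *\<^sub>v u)"
      using D u by (intro eq_vecI) (auto simp: scalar_prod_def sum_distrib_left mult.assoc)
    also have "(\<Delta> + transpose_mat \<Delta>) *\<^sub>v u = \<Delta> *\<^sub>v u + transpose_mat \<Delta> *\<^sub>v u"
      using D u by (intro add_mult_distrib_mat_vec) auto
    finally show ?thesis
      using u Du t add_scalar_prod_distrib[OF Du u] smult_scalar_prod_distrib[OF add_carrier_vec[OF Du] u]
      by simp
  qed
  moreover have "mat_adjoint ?S = ?S"
    unfolding mat_adjoint_real using D by (intro eq_matI) auto
  moreover have "square_mat ?S" "dim_row ?S = n" using S D by auto
  ultimately show ?thesis
    using c unfolding pos_def_mat_def conjugate_vec_real by (simp add: zero_less_mult_iff)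
qed

lemma pos_def_mat_add_transpose:
  assumes D: "(\<Delta> :: real mat) \<in> carrier_mat n n"
  shows "pos_def_mat (\<Delta> + transpose_mat \<Delta>) \<longleftrightarrow>
    (\<forall>u \<in> carrier_vec n. u \<noteq> 0\<^sub>v n \<longrightarrow> 0 < (\<Delta> *\<^sub>v u) \<bullet> u)"
proof -
  have "1 \<cdot>\<^sub>m (\<Delta> + transpose_mat \<Delta>) = \<Delta> + transpose_mat \<Delta>" by (intro eq_matI) auto
  then show ?thesis using pos_def_mat_symmetric_part[OF D, of 1] by simp
qed

lemma pos_def_mat_hermitian_part:
  assumes D: "(\<Delta> :: real mat) \<in> carrier_mat n n"
  shows "pos_def_mat (hermitian_part \<Delta>) \<longleftrightarrow>
    (\<forall>u \<in> carrier_vec n. u \<noteq> 0\<^sub>v n \<longrightarrow> 0 < (\<Delta> *\<^sub>v u) \<bullet> u)"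
  unfolding hermitian_part_def mat_adjoint_real
  by (rule pos_def_mat_symmetric_part[OF D]) simp

text \<open>For x = u + iv with real u, v, the real part of the form at x is the sum of the real
  forms at u and v, since \<Delta> is real.\<close>

lemma accretive_complex_mat:
  assumes D: "\<Delta> \<in> carrier_mat n n"
    and pos: "\<forall>u \<in> carrier_vec n. u \<noteq> 0\<^sub>v n \<longrightarrow> 0 < (\<Delta> *\<^sub>v u) \<bullet> u"
  shows "accretive_mat n (complex_mat \<Delta>)"
  unfolding accretive_mat_def
proof (intro conjI ballI impI)
  show C: "complex_mat \<Delta> \<in> carrier_mat n n" using D by auto
  fix x :: "complex vec" assume x: "x \<in> carrier_vec n" "x \<noteq> 0\<^sub>v n"
  define u where "u = map_vec Re x"
  define v where "v = map_vec Im x"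
  have uv: "u \<in> carrier_vec n" "v \<in> carrier_vec n" unfolding u_def v_def using x by auto
  have "u \<noteq> 0\<^sub>v n \<or> v \<noteq> 0\<^sub>v n"
  proof (rule ccontr)
    assume "\<not> ?thesis"
    then have z: "u = 0\<^sub>v n" "v = 0\<^sub>v n" by auto
    have "x $ i = 0" if "i < n" for i
      using arg_cong[OF z(1), of "\<lambda>w. w $ i"] arg_cong[OF z(2), of "\<lambda>w. w $ i"] that x
      unfolding u_def v_def by (simp add: complex_eq_iff)
    then have "x = 0\<^sub>v n" using x by (intro eq_vecI) auto
    then show False using x by simp
  qed
  moreover have "0 \<le> (\<Delta> *\<^sub>v w) \<bullet> w" if "w \<in> carrier_vec n" for w
  proof (cases "w = 0\<^sub>v n")
    case True
    then show ?thesis using D by simp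
  qed (use pos that in fastforce)
  ultimately have "0 < (\<Delta> *\<^sub>v u) \<bullet> u + (\<Delta> *\<^sub>v v) \<bullet> v"
    using pos uv by (metis add_nonneg_pos add_pos_nonneg)
  also have "\<dots> = Re (qform (complex_mat \<Delta>) x)"
    unfolding qform_sum[OF C x(1)] using D x(1)
    by (simp add: u_def v_def scalar_prod_def atLeast0LessThan sum.distrib)
  finally show "0 < Re (qform (complex_mat \<Delta>) x)" .
qed

text \<open>The vector \<open>y\<close> is a combination of \<open>x\<close> and its conjugate: as \<open>\<Delta>\<close> is real, \<open>y\<^sup>* \<Delta> y\<close> depends
  only on \<open>s = x\<^sup>* \<Delta> x\<close> and \<open>q = x\<^sup>T \<Delta> x\<close>.\<close>

lemma qform_conjugate_pair:
  fixes x :: "complex vec"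
  assumes D: "\<Delta> \<in> carrier_mat n n" and x: "x \<in> carrier_vec n"
  defines "w \<equiv> complex_mat \<Delta> *\<^sub>v x"
  defines "s \<equiv> \<Sum>i<n. w $ i * cnj (x $ i)" and "q \<equiv> \<Sum>i<n. w $ i * x $ i"
  shows "\<exists>y \<in> carrier_vec n.
    qform (complex_mat \<Delta>) y = Complex (Re s - sin \<psi> * cmod q) (cos \<psi> * Im s)"
proof -
  have C: "complex_mat \<Delta> \<in> carrier_mat n n" using D by auto
  have w: "w $ i = (\<Sum>j<n. of_real (\<Delta> $$ (i, j)) * x $ j)" if "i < n" for i
    using that D x unfolding w_def by (simp add: scalar_prod_def atLeast0LessThan)
  \<comment> \<open>Half angles give |a|^2 + |b|^2 = 1 and |a|^2 - |b|^2 = cos \<psi>, which scales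
    the imaginary part of \<open>s\<close> only. The factor \<open>cis (- Arg q)\<close> makes the
    cross term real, and the sign of \<open>a\<close> makes it - sin \<psi> |q|.\<close>
  define a where "a = - of_real (cos (\<psi> / 2)) * cis (- Arg q)"
  define b where "b = complex_of_real (sin (\<psi> / 2))"
  define y where "y = vec n (\<lambda>i. a * x $ i + b * cnj (x $ i))"
  have y: "y \<in> carrier_vec n" unfolding y_def by simp
  have "(\<Sum>j<n. complex_mat \<Delta> $$ (i, j) * y $ j) = a * w $ i + b * cnj (w $ i)" if i: "i < n" for i
    using i D w[OF i] unfolding y_def
    by (simp add: algebra_simps sum.distrib sum_distrib_left)
  then have "qform (complex_mat \<Delta>) y
      = (\<Sum>i<n. (a * w $ i + b * cnj (w $ i)) * cnj (a * x $ i + b * cnj (x $ i)))"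
    unfolding qform_sum[OF C y] by (intro sum.cong) (auto simp: y_def)
  also have "\<dots> = a * cnj a * s + b * cnj b * cnj s + (a * cnj b * q + cnj (a * cnj b * q))"
    unfolding s_def q_def by (simp add: sum.distrib sum_distrib_left algebra_simps)
  also have "a * cnj a = of_real ((cos (\<psi> / 2))\<^sup>2)"
    unfolding a_def by (simp add: power2_eq_square cis_cnj cis_mult mult_ac flip: of_real_mult)
  also have "b * cnj b = of_real ((sin (\<psi> / 2))\<^sup>2)"
    unfolding b_def by (simp add: power2_eq_square)
  also have "a * cnj b * q = - of_real (cos (\<psi> / 2) * sin (\<psi> / 2) * cmod q)"
  proof -
    have "cis (- Arg q) * q = of_real (cmod q)"
      by (subst (2) rcis_cmod_Arg[symmetric, of q]) (simp add: rcis_def cis_mult)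
    then show ?thesis unfolding a_def b_def by (simp add: algebra_simps)
  qed
  finally have "qform (complex_mat \<Delta>) y
     = of_real ((cos (\<psi> / 2))\<^sup>2) * s + of_real ((sin (\<psi> / 2))\<^sup>2) * cnj s
       - of_real (2 * sin (\<psi> / 2) * cos (\<psi> / 2) * cmod q)" by (simp add: algebra_simps)
  also have "2 * sin (\<psi> / 2) * cos (\<psi> / 2) = sin \<psi>" using sin_double[of "\<psi> / 2"] by simp
  also have "of_real ((cos (\<psi> / 2))\<^sup>2) * s + of_real ((sin (\<psi> / 2))\<^sup>2) * cnj s
      = Complex (Re s) (cos \<psi> * Im s)"
  proof -
    have "(cos (\<psi> / 2))\<^sup>2 * t + (sin (\<psi> / 2))\<^sup>2 * t = t" for t :: real
      by (simp flip: distrib_right)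
    moreover have "(cos (\<psi> / 2))\<^sup>2 * t - (sin (\<psi> / 2))\<^sup>2 * t = cos \<psi> * t" for t :: real
      using cos_double[of "\<psi> / 2"] by (simp flip: left_diff_distrib)
    ultimately show ?thesis by (simp add: complex_eq_iff)
  qed
  finally show ?thesis using y by (intro bexI[of _ y]) (auto simp: complex_eq_iff)
qed

section \<open>Kernel vectors of the perturbed matrix\<close>

lemma det_one_plus_diag_mult_eq_0_iff:
  assumes C: "(C :: 'a :: field mat) \<in> carrier_mat n n"
  shows "det (1\<^sub>m n + mat_diag n d * C) = 0 \<longleftrightarrow>
    (\<exists>x \<in> carrier_vec n. x \<noteq> 0\<^sub>v n \<and> (\<forall>i<n. x $ i + d i * (C *\<^sub>v x) $ i = 0))"
proof -
  let ?N = "1\<^sub>m n + mat_diag n d * C"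
  have N: "?N \<in> carrier_mat n n"
    using mult_carrier_mat[OF mat_diag_dim C] by simp
  have "?N *\<^sub>v x = 0\<^sub>v n \<longleftrightarrow> (\<forall>i<n. x $ i + d i * (C *\<^sub>v x) $ i = 0)" if x: "x \<in> carrier_vec n" for x
  proof -
    have "?N *\<^sub>v x = 1\<^sub>m n *\<^sub>v x + mat_diag n d * C *\<^sub>v x"
      by (rule add_mult_distrib_mat_vec[OF one_carrier_mat mult_carrier_mat[OF mat_diag_dim C] x])
    also have "1\<^sub>m n *\<^sub>v x = x" using x by simp
    finally have e: "?N *\<^sub>v x = x + mat_diag n d * C *\<^sub>v x" .
    have "(mat_diag n d * C *\<^sub>v x) $ i = d i * (C *\<^sub>v x) $ i" if "i < n" for i
      unfolding mat_diag_mult_left[OF C] using that C x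
      by (simp add: scalar_prod_def sum_distrib_left mult.assoc)
    then have "(?N *\<^sub>v x) $ i = x $ i + d i * (C *\<^sub>v x) $ i" if "i < n" for i
      using that C x unfolding e
      by (subst index_add_vec(1)) (simp_all add: carrier_matD[OF mat_diag_dim])
    moreover have "dim_vec (?N *\<^sub>v x) = n" using carrier_matD(1)[OF N] by simp
    ultimately show ?thesis by (metis (no_types, lifting) eq_vecI index_zero_vec)
  qed
  then show ?thesis unfolding det_0_iff_vec_prod_zero_field[OF N] by blast
qed

text \<open>Here \<open>p i = |x i|\<^sup>2\<close> for a kernel vector \<open>x\<close> of \<open>I + M \<Delta>\<close>, \<open>R + i J = x\<^sup>* \<Delta> x\<close> and
  \<open>Q = |x\<^sup>T \<Delta> x|\<close>. Since \<open>x\<^sup>T \<Delta> x\<close> is a sum of complex numbers of moduli \<open>p i\<close>, the bound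
  \<open>p 0 - \<Sum>i<k. p (Suc i) \<le> Q\<close> is the triangle inequality.\<close>

lemma singular_perturbation_data:
  assumes D: "\<Delta> \<in> carrier_mat (Suc k) (Suc k)" and acc: "accretive_mat (Suc k) (complex_mat \<Delta>)"
    and det: "det (1\<^sub>m (Suc k) + mat_diag (Suc k) (\<lambda>i. cis (\<nu> i)) * complex_mat \<Delta>) = 0"
  obtains p :: "nat \<Rightarrow> real" and R J Q :: real where
    "\<And>i. 0 \<le> p i" "R = - (\<Sum>i<Suc k. p i * cos (\<nu> i))" "J = (\<Sum>i<Suc k. p i * sin (\<nu> i))"
    "0 < R" "Q \<le> R" "p 0 - (\<Sum>i<k. p (Suc i)) \<le> Q"
    "\<And>\<psi>. \<exists>y \<in> carrier_vec (Suc k). qform (complex_mat \<Delta>) y = Complex (R - sin \<psi> * Q) (cos \<psi> * J)"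
proof -
  let ?n = "Suc k"
  have C: "complex_mat \<Delta> \<in> carrier_mat ?n ?n" using D by auto
  from det obtain x where x: "x \<in> carrier_vec ?n" "x \<noteq> 0\<^sub>v ?n"
    and x0: "\<forall>i<?n. x $ i + cis (\<nu> i) * (complex_mat \<Delta> *\<^sub>v x) $ i = 0"
    unfolding det_one_plus_diag_mult_eq_0_iff[OF C] by blast
  define w where "w = complex_mat \<Delta> *\<^sub>v x"
  define s where "s = (\<Sum>i<?n. w $ i * cnj (x $ i))"
  define q where "q = (\<Sum>i<?n. w $ i * x $ i)"
  define p where "p = (\<lambda>i. (cmod (x $ i))\<^sup>2)"
  have w: "w $ i = - cis (- \<nu> i) * x $ i" if "i < ?n" for i
  proof -
    have "w $ i = cis (- \<nu> i) * (cis (\<nu> i) * w $ i)"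
      by (simp add: mult.assoc[symmetric] cis_mult)
    also have "cis (\<nu> i) * w $ i = - x $ i"
      using x0 that unfolding w_def by (simp add: add_eq_0_iff)
    finally show ?thesis by simp
  qed
  have s_eq: "s = (\<Sum>i<?n. - cis (- \<nu> i) * of_real (p i))"
    unfolding s_def p_def
    by (intro sum.cong) (simp_all add: w complex_norm_square mult.assoc del: of_real_power)
  have "cmod (w $ i * x $ i) = p i" if "i < ?n" for i
    using w[OF that] by (simp add: norm_mult p_def power2_eq_square)
  then have nq: "cmod (w $ 0 * x $ 0) = p 0" "cmod (\<Sum>i<k. w $ Suc i * x $ Suc i) \<le> (\<Sum>i<k. p (Suc i))"
    by (auto intro!: sum_norm_le)
  have "w $ 0 * x $ 0 = q - (\<Sum>i<k. w $ Suc i * x $ Suc i)"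
    unfolding q_def sum.lessThan_Suc_shift by simp
  then have 6: "p 0 - (\<Sum>i<k. p (Suc i)) \<le> cmod q"
    using nq norm_triangle_ineq4[of q "\<Sum>i<k. w $ Suc i * x $ Suc i"] by simp
  note range = qform_conjugate_pair[OF D x(1), folded w_def, folded s_def q_def]
  have Re_s: "Re s = - (\<Sum>i<?n. p i * cos (\<nu> i))"
    unfolding s_eq Re_sum sum_negf[symmetric] by (intro sum.cong) simp_all
  have Im_s: "Im s = (\<Sum>i<?n. p i * sin (\<nu> i))"
    unfolding s_eq Im_sum by (intro sum.cong) simp_all
  have "qform (complex_mat \<Delta>) x = s"
    using C x unfolding qform_def s_def w_def by (simp add: scalar_prod_def atLeast0LessThan)
  then have 4: "0 < Re s" using acc x unfolding accretive_mat_def by metis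
  have "0 \<le> Re (qform (complex_mat \<Delta>) y)" if "y \<in> carrier_vec ?n" for y
  proof (cases "y = 0\<^sub>v ?n")
    case True
    then show ?thesis unfolding qform_def using C by simp
  next
    case False
    then show ?thesis using acc that unfolding accretive_mat_def by fastforce
  qed
  \<comment> \<open>At \<psi> = pi/2 the real part in \<open>range\<close> is
    \<open>Re s - cmod q\<close>.\<close>
  then have 5: "cmod q \<le> Re s" using range[of "pi / 2"] by fastforce
  show ?thesis
    by (rule that[OF _ Re_s Im_s 4 5 6 range]) (simp add: p_def)
qed

section \<open>Nonexistence and the lower bound on the largest phase\<close>

text \<open>For i \<ge> 1 the angle \<sigma> - \<nu> i lies in [\<delta>, pi - \<delta>), where the
  sine is at least sin \<delta>; for i = 0 the angle is exactly -\<delta>.\<close>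

lemma sum_sin_lower_bound:
  fixes p \<nu> :: "nat \<Rightarrow> real"
  assumes p: "\<And>i. 0 \<le> p i"
    and le: "\<And>i. 1 \<le> i \<Longrightarrow> i \<le> k \<Longrightarrow> \<nu> i \<le> \<nu> 1" and "\<nu> 1 \<le> \<nu> 0"
    and gap: "\<And>i. i \<le> k \<Longrightarrow> \<nu> 0 - \<nu> i < pi" and k: "1 \<le> k"
  defines "\<sigma> \<equiv> (\<nu> 0 + \<nu> 1) / 2" and "\<delta> \<equiv> (\<nu> 0 - \<nu> 1) / 2"
  shows "sin \<delta> * ((\<Sum>i<k. p (Suc i)) - p 0) \<le> (\<Sum>i<Suc k. p i * sin (\<sigma> - \<nu> i))"
proof -
  have "sin \<delta> \<le> sin (\<sigma> - \<nu> (Suc i))" if i: "i < k" for i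
  proof -
    define x where "x = \<sigma> - \<nu> (Suc i)"
    have x: "\<delta> \<le> x" "x < pi - \<delta>"
      using le[of "Suc i"] gap[of "Suc i"] i unfolding x_def \<sigma>_def \<delta>_def by (auto simp: field_simps)
    have d: "0 \<le> \<delta>" using assms(3) unfolding \<delta>_def by simp
    have "0 \<le> sin ((x - \<delta>) / 2)" using x d by (intro sin_ge_zero) (auto simp: field_simps)
    moreover have "0 \<le> cos ((x + \<delta>) / 2)" using x d by (intro cos_ge_zero) (auto simp: field_simps)
    ultimately have "0 \<le> sin x - sin \<delta>" unfolding sin_diff_sin by simp
    then show ?thesis unfolding x_def by simp
  qed
  then have "(\<Sum>i<k. sin \<delta> * p (Suc i)) \<le> (\<Sum>i<k. p (Suc i) * sin (\<sigma> - \<nu> (Suc i)))"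
    by (intro sum_mono) (simp add: mult.commute[of "sin \<delta>"] mult_left_mono p)
  moreover have "sin (\<sigma> - \<nu> 0) = - sin \<delta>"
  proof -
    have "\<sigma> - \<nu> 0 = - \<delta>" unfolding \<sigma>_def \<delta>_def by (simp add: field_simps)
    then show ?thesis by simp
  qed
  ultimately show ?thesis
    unfolding sum.lessThan_Suc_shift by (simp add: sum_distrib_left[symmetric] algebra_simps)
qed

text \<open>If \<nu> 0 \<le> pi/2, all cosines are nonnegative and R \<le> 0. Otherwise put c = -
  cos (\<nu> 0), which lies in (0, 1). For i \<ge> 1 one has |\<nu> i| \<le> pi - \<nu> 0, hence cos
  (\<nu> i) \<ge> c. With S = p 0 minus the other weights this gives 0 < R \<le> c S < S \<le> Q,
  against Q \<le> R.\<close>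

lemma no_singular_perturbation:
  fixes \<nu> :: "nat \<Rightarrow> real"
  assumes D: "\<Delta> \<in> carrier_mat (Suc k) (Suc k)" and acc: "accretive_mat (Suc k) (complex_mat \<Delta>)"
    and det: "det (1\<^sub>m (Suc k) + mat_diag (Suc k) (\<lambda>i. cis (\<nu> i)) * complex_mat \<Delta>) = 0"
    and le: "\<And>i. 1 \<le> i \<Longrightarrow> i \<le> k \<Longrightarrow> \<nu> i \<le> \<nu> 1" "\<nu> 1 \<le> \<nu> 0"
    and gap: "\<And>i. i \<le> k \<Longrightarrow> \<nu> 0 - \<nu> i < pi"
    and low: "\<And>i. i \<le> k \<Longrightarrow> - pi / 2 < \<nu> i" and up: "\<nu> 0 < pi"
    and sum: "\<nu> 0 + \<nu> 1 \<le> pi"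
  shows False
proof -
  obtain p R J Q where p: "\<And>i. 0 \<le> p i" and R: "R = - (\<Sum>i<Suc k. p i * cos (\<nu> i))"
    and Q: "0 < R" "Q \<le> R" "p 0 - (\<Sum>i<k. p (Suc i)) \<le> Q"
    by (rule singular_perturbation_data[OF D acc det]) (rule that)
  define c where "c = - cos (\<nu> 0)"
  show False
  proof (cases "\<nu> 0 \<le> pi / 2")
    case True
    have "0 \<le> cos (\<nu> i)" if "i \<le> k" for i
      using le(1)[of i] le(2) low[of i] True that
      by (cases "i = 0") (auto intro!: cos_ge_zero)
    then have "0 \<le> (\<Sum>i<Suc k. p i * cos (\<nu> i))"
      by (intro sum_nonneg mult_nonneg_nonneg p) auto
    then show False using R Q by simp
  next
    case False
    have "cos pi < cos (\<nu> 0)" using False up by (intro cos_monotone_0_pi) auto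
    moreover have "cos (\<nu> 0) < cos (pi / 2)" using False up by (intro cos_monotone_0_pi) auto
    ultimately have c: "0 < c" "c < 1" unfolding c_def by auto
    have "c \<le> cos (\<nu> (Suc i))" if i: "i < k" for i
    proof -
      have "c = cos (pi - \<nu> 0)" unfolding c_def by (simp add: cos_diff)
      also have "\<dots> \<le> cos \<bar>\<nu> (Suc i)\<bar>"
        using le(1)[of "Suc i"] gap[of "Suc i"] sum i up False
        by (intro cos_monotone_0_pi_le) auto
      finally show ?thesis by simp
    qed
    then have "(\<Sum>i<k. c * p (Suc i)) \<le> (\<Sum>i<k. p (Suc i) * cos (\<nu> (Suc i)))"
      by (intro sum_mono) (simp add: mult.commute[of c] mult_left_mono p)
    then have "c * (\<Sum>i<k. p (Suc i)) \<le> (\<Sum>i<k. p (Suc i) * cos (\<nu> (Suc i)))"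
      unfolding sum_distrib_left .
    then have "R \<le> c * (p 0 - (\<Sum>i<k. p (Suc i)))"
      unfolding R sum.lessThan_Suc_shift by (simp add: c_def right_diff_distrib)
    moreover from this have "0 < c * (p 0 - (\<Sum>i<k. p (Suc i)))" using Q(1) by linarith
    then have "0 < p 0 - (\<Sum>i<k. p (Suc i))" using c by (simp add: zero_less_mult_iff)
    then have "c * (p 0 - (\<Sum>i<k. p (Suc i))) < p 0 - (\<Sum>i<k. p (Suc i))"
      using c by simp
    ultimately show False using Q by simp
  qed
qed

text \<open>The family \<open>rng\<close> bounds the pairing of (J cos \<theta>, Q sin \<theta>)
  with every unit vector. Taking the unit vector along (- cos \<sigma> sin \<theta>, sin \<delta>
  cos \<theta>) produces the right-hand side of \<open>main\<close>, and squaring leaves the claimed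
  bound.\<close>

lemma cos_bound_from_range:
  fixes \<theta> \<sigma> \<delta> R J Q K :: real
  assumes c: "0 < cos \<theta>" and R: "0 < R" "Q \<le> R"
    and rng: "\<And>\<psi>. cos \<psi> * J * cos \<theta> + sin \<psi> * sin \<theta> * Q \<le> R * sin \<theta>"
    and main: "R * sin \<sigma> \<le> - cos \<sigma> * J + sin \<delta> * Q"
    and sgn: "cos \<sigma> < 0" "0 \<le> sin \<delta>" "sin \<delta> < sin \<sigma>" "0 < cos \<delta>"
  shows "0 \<le> sin \<theta>" "cos \<theta> \<le> - cos \<sigma> / cos \<delta>"
proof -
  let ?s = "sin \<theta>" and ?c = "cos \<theta>"
  have J: "J * ?c \<le> R * ?s" "- (J * ?c) \<le> R * ?s" using rng[of 0] rng[of pi] by auto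
  then have "0 \<le> R * ?s" by linarith
  then show s: "0 \<le> ?s" using R(1) by (simp add: zero_le_mult_iff)
  \<comment> \<open>If sin \<theta> = 0, then J = 0, and \<open>main\<close> with Q \<le> R would
    force sin \<sigma> \<le> sin \<delta>.\<close>
  have "?s \<noteq> 0"
  proof
    assume "?s = 0"
    then have "J = 0" using J c by (simp add: mult_le_0_iff zero_le_mult_iff)
    then have "R * sin \<sigma> \<le> sin \<delta> * R"
      using main mult_left_mono[OF R(2) sgn(2)] by simp
    then show False using R(1) sgn(3) by (simp add: mult.commute)
  qed
  then have s: "0 < ?s" using s by simp
  \<comment> \<open>The length of the chosen direction, used to normalise it to (cos \<psi>, sin
    \<psi>).\<close>
  define N where "N = sqrt ((cos \<sigma> * ?s)\<^sup>2 + (sin \<delta> * ?c)\<^sup>2)"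
  have "0 < (cos \<sigma> * ?s)\<^sup>2" using s sgn(1) by simp
  then have N: "0 < N" "N\<^sup>2 = (cos \<sigma> * ?s)\<^sup>2 + (sin \<delta> * ?c)\<^sup>2"
    unfolding N_def by (auto intro: add_pos_nonneg)
  have "(- cos \<sigma> * ?s / N)\<^sup>2 + (sin \<delta> * ?c / N)\<^sup>2 = 1"
    using N unfolding power_divide by (simp flip: N(2) add_divide_distrib)
  then obtain \<psi> where \<psi>: "- cos \<sigma> * ?s / N = cos \<psi>" "sin \<delta> * ?c / N = sin \<psi>"
    using sincos_total_2pi by metis
  have "?s * ?c * (- cos \<sigma> * J + sin \<delta> * Q) / N \<le> R * ?s"
    using rng[of \<psi>] unfolding \<psi>[symmetric] by (simp add: algebra_simps diff_divide_distrib add_divide_distrib)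
  then have "?s * (?c * (- cos \<sigma> * J + sin \<delta> * Q)) \<le> ?s * (R * N)"
    using N(1) by (simp add: field_simps)
  then have "?c * (- cos \<sigma> * J + sin \<delta> * Q) \<le> R * N" using s by simp
  moreover have "?c * (R * sin \<sigma>) \<le> ?c * (- cos \<sigma> * J + sin \<delta> * Q)"
    using main c by (intro mult_left_mono) auto
  ultimately have "R * (sin \<sigma> * ?c) \<le> R * N" by (simp add: mult_ac)
  then have "sin \<sigma> * ?c \<le> N" using R(1) by simp
  then have "(sin \<sigma> * ?c)\<^sup>2 \<le> N\<^sup>2" using c sgn by (intro power_mono) auto
  then have "(sin \<sigma>)\<^sup>2 * ?c\<^sup>2 \<le> (cos \<sigma>)\<^sup>2 * (1 - ?c\<^sup>2) + (1 - (cos \<delta>)\<^sup>2) * ?c\<^sup>2"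
    unfolding N(2) by (simp add: power_mult_distrib sin_squared_eq)
  then have "(cos \<delta> * ?c)\<^sup>2 \<le> (- cos \<sigma>)\<^sup>2"
    by (simp add: power_mult_distrib sin_squared_eq algebra_simps)
  then have "cos \<delta> * ?c \<le> - cos \<sigma>" by (rule power2_le_imp_le) (use sgn(1) in simp)
  then show "?c \<le> - cos \<sigma> / cos \<delta>" using sgn(4) by (simp add: field_simps)
qed

text \<open>The hypotheses amount to pi/2 < \<sigma> < pi and 0 \<le> \<delta> < pi - \<sigma>. The
  ratio thus lies in (0, 1), so its \<open>arccos\<close> is an acute positive angle.\<close>

lemma half_angle_facts:
  fixes a b :: real
  assumes "b \<le> a" "a < pi" "a - b < pi" "pi < a + b"
  defines "\<sigma> \<equiv> (a + b) / 2" and "\<delta> \<equiv> (a - b) / 2"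
  shows "cos \<sigma> < 0" "0 \<le> sin \<delta>" "sin \<delta> < sin \<sigma>" "0 < cos \<delta>"
    "0 < - cos \<sigma> / cos \<delta>" "- cos \<sigma> / cos \<delta> < 1"
proof -
  have r: "pi / 2 < \<sigma>" "\<sigma> < pi" "0 \<le> \<delta>" "\<delta> < pi - \<sigma>" "\<delta> < pi / 2"
    using assms unfolding \<sigma>_def \<delta>_def by (auto simp: field_simps)
  have "cos \<sigma> < cos (pi / 2)" using r by (intro cos_monotone_0_pi) auto
  then show 1: "cos \<sigma> < 0" by simp
  show "0 \<le> sin \<delta>" using r by (intro sin_ge_zero) auto
  have "sin \<delta> < sin (pi - \<sigma>)" using r by (intro sin_monotone_2pi) auto
  then show "sin \<delta> < sin \<sigma>" by (simp add: sin_diff)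
  show 4: "0 < cos \<delta>" using r by (intro cos_gt_zero_pi) auto
  have "cos (pi - \<sigma>) < cos \<delta>" using r by (intro cos_monotone_0_pi) auto
  then have "- cos \<sigma> < cos \<delta>" by (simp add: cos_diff)
  then show "0 < - cos \<sigma> / cos \<delta>" "- cos \<sigma> / cos \<delta> < 1"
    using 1 4 by (simp_all add: divide_less_0_iff pos_less_divide_eq)

qed

text \<open>The sector bound at the vectors built from a kernel vector and its conjugate gives the
  range inequality; the sine estimate gives the linear one. Together they bound cos \<theta> from
  above, and sin \<theta> \<ge> 0 allows passing to \<open>arccos\<close>.\<close>

lemma largest_phase_lower_bound:
  fixes \<nu> :: "nat \<Rightarrow> real"
  assumes D: "\<Delta> \<in> carrier_mat (Suc k) (Suc k)" and acc: "accretive_mat (Suc k) (complex_mat \<Delta>)"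
    and det: "det (1\<^sub>m (Suc k) + mat_diag (Suc k) (\<lambda>i. cis (\<nu> i)) * complex_mat \<Delta>) = 0"
    and k: "1 \<le> k" and le: "\<And>i. 1 \<le> i \<Longrightarrow> i \<le> k \<Longrightarrow> \<nu> i \<le> \<nu> 1" "\<nu> 1 \<le> \<nu> 0"
    and gap: "\<And>i. i \<le> k \<Longrightarrow> \<nu> 0 - \<nu> i < pi"
    and up: "\<nu> 0 < pi" and sum: "pi < \<nu> 0 + \<nu> 1"
  shows "arccos (- (cos ((\<nu> 0 + \<nu> 1) / 2) / cos ((\<nu> 0 - \<nu> 1) / 2))) \<le> largest_phase (complex_mat \<Delta>)"
proof -
  define \<sigma> where "\<sigma> = (\<nu> 0 + \<nu> 1) / 2"
  define \<delta> where "\<delta> = (\<nu> 0 - \<nu> 1) / 2"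
  define \<theta> where "\<theta> = largest_phase (complex_mat \<Delta>)"
  note trig = half_angle_facts[OF le(2) up gap[OF k] sum, folded \<sigma>_def \<delta>_def]
  obtain p R J Q where p: "\<And>i. 0 \<le> p i" and R: "R = - (\<Sum>i<Suc k. p i * cos (\<nu> i))"
    and J: "J = (\<Sum>i<Suc k. p i * sin (\<nu> i))"
    and Q: "0 < R" "Q \<le> R" "p 0 - (\<Sum>i<k. p (Suc i)) \<le> Q"
    and rng: "\<And>\<psi>. \<exists>y \<in> carrier_vec (Suc k).
      qform (complex_mat \<Delta>) y = Complex (R - sin \<psi> * Q) (cos \<psi> * J)"
    by (rule singular_perturbation_data[OF D acc det]) (rule that)
  have acc_th: "- pi / 2 < \<theta>" "\<theta> < pi / 2"
    "\<And>y. y \<in> carrier_vec (Suc k) \<Longrightarrow> Im (cis (- \<theta>) * qform (complex_mat \<Delta>) y) \<le> 0"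
    using largest_phase_extremal[OF acc] unfolding \<theta>_def by auto
  have c: "0 < cos \<theta>" using acc_th by (intro cos_gt_zero_pi) auto
  have "cos \<psi> * J * cos \<theta> + sin \<psi> * sin \<theta> * Q \<le> R * sin \<theta>" for \<psi>
  proof -
    obtain y where "y \<in> carrier_vec (Suc k)"
      "qform (complex_mat \<Delta>) y = Complex (R - sin \<psi> * Q) (cos \<psi> * J)" using rng by blast
    then show ?thesis using acc_th(3)[of y] by (simp add: algebra_simps)
  qed
  moreover have "R * sin \<sigma> \<le> - cos \<sigma> * J + sin \<delta> * Q"
  proof -
    have "R * sin \<sigma> + cos \<sigma> * J = - (\<Sum>i<Suc k. p i * sin (\<sigma> - \<nu> i))"
      unfolding R J sin_diff
      by (simp add: sum_distrib_left sum_subtractf sum_negf algebra_simps del: sum.lessThan_Suc)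
    also have "\<dots> \<le> sin \<delta> * (p 0 - (\<Sum>i<k. p (Suc i)))"
      using sum_sin_lower_bound[OF p le gap k, folded \<sigma>_def \<delta>_def] by (simp add: algebra_simps)
    also have "\<dots> \<le> sin \<delta> * Q" using Q(3) trig(2) by (intro mult_left_mono)
    finally show ?thesis by simp
  qed
  ultimately have s: "0 \<le> sin \<theta>" "cos \<theta> \<le> - cos \<sigma> / cos \<delta>"
    using cos_bound_from_range[OF c Q(1,2) _ _ trig(1-4)] by blast+
  have "0 \<le> \<theta>"
  proof (rule ccontr)
    assume "\<not> 0 \<le> \<theta>"
    then have "0 < sin (- \<theta>)" using acc_th by (intro sin_gt_zero) auto
    then show False using s by simp
  qed
  then have "arccos (cos \<theta>) = \<theta>" using acc_th by (intro arccos_cos) auto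
  moreover have "arccos (- cos \<sigma> / cos \<delta>) \<le> arccos (cos \<theta>)"
    using s trig(5,6) by (intro arccos_le_arccos) auto
  ultimately show ?thesis unfolding \<theta>_def \<sigma>_def \<delta>_def by simp
qed

section \<open>The extremal perturbation\<close>

text \<open>The matrix is normal with eigenvalues \<open>cis \<theta>\<close>,
  \<open>cis (- \<theta>)\<close> and 1, so for 0 < \<theta> < pi/2 its largest phase is
  \<theta>.\<close>

definition rotation_perturbation :: "nat \<Rightarrow> real \<Rightarrow> real mat" where
  "rotation_perturbation n \<theta> = mat n n (\<lambda>(i, j).
     if i = j then (if i < 2 then cos \<theta> else 1)
     else if i = 0 \<and> j = 1 then sin \<theta> else if i = 1 \<and> j = 0 then - sin \<theta> else 0)"

lemma rotation_perturbation_carrier [simp]: "rotation_perturbation n \<theta> \<in> carrier_mat n n"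
  unfolding rotation_perturbation_def by simp

text \<open>The general scalar type lets one computation serve the real vectors of the positivity
  proof and the complex vectors of the phase and kernel computations.\<close>

lemma rotation_perturbation_row:
  fixes x :: "nat \<Rightarrow> 'a :: real_algebra_1"
  assumes n: "2 \<le> n" and i: "i < n"
  shows "(\<Sum>j<n. of_real (rotation_perturbation n \<theta> $$ (i, j)) * x j) =
    (if i = 0 then of_real (cos \<theta>) * x 0 + of_real (sin \<theta>) * x 1
     else if i = 1 then of_real (cos \<theta>) * x 1 - of_real (sin \<theta>) * x 0 else x i)"
proof -
  obtain r where r: "n = Suc (Suc r)" using n by (metis add_2_eq_Suc le_Suc_ex)
  have "(\<Sum>j<r. of_real (rotation_perturbation n \<theta> $$ (i, Suc (Suc j))) * x (Suc (Suc j)))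
      = (\<Sum>j<r. if i = Suc (Suc j) then x i else 0)"
    using i by (intro sum.cong) (auto simp: rotation_perturbation_def r)
  also have "\<dots> = (if i < 2 then 0 else x i)"
  proof (cases "i < 2")
    case False
    then obtain i' where i': "i = Suc (Suc i')" by (metis add_2_eq_Suc le_Suc_ex not_less)
    then show ?thesis using i r by simp
  qed (auto intro!: sum.neutral)
  finally have "(\<Sum>j<n. of_real (rotation_perturbation n \<theta> $$ (i, j)) * x j)
      = of_real (rotation_perturbation n \<theta> $$ (i, 0)) * x 0
        + (of_real (rotation_perturbation n \<theta> $$ (i, 1)) * x 1 + (if i < 2 then 0 else x i))"
    unfolding r sum.lessThan_Suc_shift by simp
  also have "\<dots> = (if i = 0 then of_real (cos \<theta>) * x 0 + of_real (sin \<theta>) * x 1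
     else if i = 1 then of_real (cos \<theta>) * x 1 - of_real (sin \<theta>) * x 0 else x i)"
    using i n by (auto simp: rotation_perturbation_def)
  finally show ?thesis .
qed

text \<open>The weight \<open>g\<close> is left free: it becomes the vector itself for the real form
  and its conjugate for the complex one.\<close>

lemma rotation_perturbation_form:
  fixes x g :: "nat \<Rightarrow> 'a :: real_algebra_1"
  assumes n: "n = Suc (Suc r)"
  shows "(\<Sum>i<n. (\<Sum>j<n. of_real (rotation_perturbation n \<theta> $$ (i, j)) * x j) * g i) =
    (of_real (cos \<theta>) * x 0 + of_real (sin \<theta>) * x 1) * g 0
    + ((of_real (cos \<theta>) * x 1 - of_real (sin \<theta>) * x 0) * g 1
       + (\<Sum>i<r. x (Suc (Suc i)) * g (Suc (Suc i))))"
proof -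
  have n2: "2 \<le> n" using n by simp
  have "(\<Sum>i<n. (\<Sum>j<n. of_real (rotation_perturbation n \<theta> $$ (i, j)) * x j) * g i)
    = (\<Sum>i<n. (if i = 0 then of_real (cos \<theta>) * x 0 + of_real (sin \<theta>) * x 1
     else if i = 1 then of_real (cos \<theta>) * x 1 - of_real (sin \<theta>) * x 0 else x i) * g i)"
    by (intro sum.cong refl) (simp only: rotation_perturbation_row[OF n2] lessThan_iff)
  then show ?thesis unfolding n sum.lessThan_Suc_shift by simp
qed

text \<open>The sine terms are skew and cancel, leaving a sum of squares with weights cos \<theta>
  and 1.\<close>

lemma rotation_perturbation_pos:
  assumes n: "2 \<le> n" and c: "0 < cos \<theta>" and u: "u \<in> carrier_vec n" "u \<noteq> 0\<^sub>v n"
  shows "0 < (rotation_perturbation n \<theta> *\<^sub>v u) \<bullet> u"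
proof -
  let ?D = "rotation_perturbation n \<theta>"
  obtain r where r: "n = Suc (Suc r)" using n by (metis add_2_eq_Suc le_Suc_ex)
  have "(?D *\<^sub>v u) \<bullet> u = (\<Sum>i<n. (\<Sum>j<n. of_real (?D $$ (i, j)) * u $ j) * u $ i)"
    using u carrier_matD[OF rotation_perturbation_carrier[of n \<theta>]]
    by (simp add: scalar_prod_def atLeast0LessThan)
  also have "\<dots> = cos \<theta> * ((u $ 0)\<^sup>2 + (u $ 1)\<^sup>2) + (\<Sum>i<r. (u $ Suc (Suc i))\<^sup>2)"
    unfolding rotation_perturbation_form[OF r] by (simp add: power2_eq_square algebra_simps)
  finally have eq: "(?D *\<^sub>v u) \<bullet> u
    = cos \<theta> * ((u $ 0)\<^sup>2 + (u $ 1)\<^sup>2) + (\<Sum>i<r. (u $ Suc (Suc i))\<^sup>2)" .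
  have "\<exists>i<n. u $ i \<noteq> 0"
  proof (rule ccontr)
    assume "\<not> ?thesis"
    then have "u = 0\<^sub>v n" using u by (intro eq_vecI) auto
    then show False using u by simp
  qed
  then obtain i where i: "i < n" "u $ i \<noteq> 0" by blast
  show ?thesis
  proof (cases "i < 2")
    case True
    then have "u $ 0 \<noteq> 0 \<or> u $ 1 \<noteq> 0" using i by (metis less_2_cases One_nat_def)
    then have "0 < cos \<theta> * ((u $ 0)\<^sup>2 + (u $ 1)\<^sup>2)"
      using c by (simp add: sum_power2_gt_zero_iff)
    moreover have "0 \<le> (\<Sum>i<r. (u $ Suc (Suc i))\<^sup>2)" by (intro sum_nonneg) simp
    ultimately show ?thesis unfolding eq by linarith
  next
    case False
    then obtain i' where i': "i = Suc (Suc i')" by (metis add_2_eq_Suc le_Suc_ex not_less)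
    have "0 < (\<Sum>i<r. (u $ Suc (Suc i))\<^sup>2)"
      by (rule sum_pos2[of _ i']) (use i i' r in auto)
    moreover have "0 \<le> cos \<theta> * ((u $ 0)\<^sup>2 + (u $ 1)\<^sup>2)" using c by simp
    ultimately show ?thesis unfolding eq by linarith
  qed
qed

text \<open>After rotation by -\<theta> the first block contributes a nonnegative multiple of 2 Im
  (b cnj a) - |a|^2 - |b|^2, which is nonpositive as minus a sum of two squares; the identity block
  contributes - B sin \<theta>.\<close>

lemma rotation_perturbation_phase:
  assumes n: "2 \<le> n" and c: "0 < cos \<theta>" and s: "0 < sin \<theta>" and y: "y \<in> carrier_vec n"
  shows "Im (cis (- \<theta>) * qform (complex_mat (rotation_perturbation n \<theta>)) y) \<le> 0"
proof -
  let ?D = "rotation_perturbation n \<theta>"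
  obtain r where r: "n = Suc (Suc r)" using n by (metis add_2_eq_Suc le_Suc_ex)
  have C: "complex_mat ?D \<in> carrier_mat n n" by simp
  define a where "a = y $ 0"
  define b where "b = y $ 1"
  define A where "A = (cmod a)\<^sup>2 + (cmod b)\<^sup>2"
  define B where "B = (\<Sum>i<r. (cmod (y $ Suc (Suc i)))\<^sup>2)"
  have B: "0 \<le> B" unfolding B_def by (intro sum_nonneg) simp
  have "qform (complex_mat ?D) y = (\<Sum>i<n. (\<Sum>j<n. of_real (?D $$ (i, j)) * y $ j) * cnj (y $ i))"
    unfolding qform_sum[OF C y] using carrier_matD[OF rotation_perturbation_carrier[of n \<theta>]]
    by (intro sum.cong) auto
  also have "\<dots> = (of_real (cos \<theta>) * a + of_real (sin \<theta>) * b) * cnj a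
      + ((of_real (cos \<theta>) * b - of_real (sin \<theta>) * a) * cnj b + of_real B)"
    unfolding B_def a_def b_def of_real_sum complex_norm_square rotation_perturbation_form[OF r] ..
  also have "\<dots> = of_real (cos \<theta> * A + B) + of_real (sin \<theta>) * (b * cnj a - a * cnj b)"
    unfolding A_def of_real_add of_real_mult complex_norm_square by (simp add: algebra_simps)
  also have "b * cnj a - a * cnj b = Complex 0 (2 * Im (b * cnj a))"
    by (simp add: complex_eq_iff algebra_simps)
  finally have q: "qform (complex_mat ?D) y
    = of_real (cos \<theta> * A + B) + of_real (sin \<theta>) * Complex 0 (2 * Im (b * cnj a))" .
  have "Im (cis (- \<theta>) * qform (complex_mat ?D) y)
      = sin \<theta> * cos \<theta> * (2 * Im (b * cnj a) - A) - sin \<theta> * B"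
    unfolding q by (simp add: algebra_simps)
  moreover have "2 * Im (b * cnj a) \<le> A"
    using zero_le_power2[of "Im b - Re a"] zero_le_power2[of "Re b + Im a"]
    unfolding A_def cmod_power2 by (simp add: power2_eq_square algebra_simps)
  then have "sin \<theta> * cos \<theta> * (2 * Im (b * cnj a) - A) \<le> 0"
    using c s by (intro mult_nonneg_nonpos) auto
  moreover have "0 \<le> sin \<theta> * B" using s B by simp
  ultimately show ?thesis by linarith
qed

text \<open>The leading 2 by 2 block has determinant 1 + (e + f) cos \<theta> + e f = 2 cis \<sigma>
  (cos \<theta> cos \<delta> + cos \<sigma>), and the hypothesis on \<theta> says that the last
  factor is 0.\<close>

lemma rotation_perturbation_singular:
  assumes n: "2 \<le> n" and s: "0 < sin \<theta>"
    and \<theta>: "cos \<theta> * cos ((\<nu> 0 - \<nu> 1) / 2) = - cos ((\<nu> 0 + \<nu> 1) / 2)"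
  shows "det (1\<^sub>m n + mat_diag n (\<lambda>i. cis (\<nu> i)) * complex_mat (rotation_perturbation n \<theta>)) = 0"
proof -
  let ?D = "rotation_perturbation n \<theta>"
  have C: "complex_mat ?D \<in> carrier_mat n n" by simp
  define e where "e = cis (\<nu> 0)"
  define f where "f = cis (\<nu> 1)"
  define \<sigma> where "\<sigma> = (\<nu> 0 + \<nu> 1) / 2"
  define \<delta> where "\<delta> = (\<nu> 0 - \<nu> 1) / 2"
  define k where "k = complex_of_real (cos \<theta>)"
  define m where "m = complex_of_real (sin \<theta>)"
  have ef: "e = cis \<sigma> * cis \<delta>" "f = cis \<sigma> * cis (- \<delta>)"
    unfolding e_def f_def \<sigma>_def \<delta>_def by (simp_all add: cis_mult field_simps)
  have "cis \<delta> + cis (- \<delta>) = of_real (2 * cos \<delta>)" "cis \<sigma> + cis (- \<sigma>) = of_real (2 * cos \<sigma>)"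
    by (simp_all add: complex_eq_iff)
  note cc = this
  have "1 + e * f = cis \<sigma> * (cis \<sigma> + cis (- \<sigma>))"
    unfolding ef by (simp add: cis_mult algebra_simps)
  then have "1 + (e + f) * k + e * f
      = cis \<sigma> * ((cis \<delta> + cis (- \<delta>)) * k + (cis \<sigma> + cis (- \<sigma>)))"
    by (simp add: ef algebra_simps)
  also have "\<dots> = cis \<sigma> * of_real (2 * (cos \<theta> * cos \<delta> + cos \<sigma>))"
    unfolding cc k_def by (simp add: algebra_simps)
  also have "\<dots> = 0" using \<theta> unfolding \<sigma>_def \<delta>_def by simp
  finally have z: "1 + (e + f) * k + e * f = 0" .
  have "cos \<theta> * cos \<theta> + sin \<theta> * sin \<theta> = 1" by (simp flip: power2_eq_square)
  then have km: "k * k + m * m = 1"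
    unfolding k_def m_def by (metis of_real_1 of_real_add of_real_mult)
  \<comment> \<open>This solves row 0, which reads (1 + e k) x_0 + e m x_1 = 0; row 1 then holds
    because the determinant of the block vanishes.\<close>
  define x where "x = vec n (\<lambda>i. if i = 0 then - (e * m) else if i = 1 then 1 + e * k else 0)"
  have x: "x \<in> carrier_vec n" unfolding x_def by simp
  have "x $ 0 \<noteq> 0" using n s unfolding x_def e_def m_def by simp
  then have "x \<noteq> 0\<^sub>v n" using n by auto
  moreover have "x $ i + cis (\<nu> i) * (complex_mat ?D *\<^sub>v x) $ i = 0" if i: "i < n" for i
  proof -
    have "(complex_mat ?D *\<^sub>v x) $ i = (\<Sum>j<n. of_real (?D $$ (i, j)) * x $ j)"
      using i x carrier_matD[OF rotation_perturbation_carrier[of n \<theta>]]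
      by (simp add: scalar_prod_def atLeast0LessThan)
    also have "\<dots> = (if i = 0 then k * x $ 0 + m * x $ 1
        else if i = 1 then k * x $ 1 - m * x $ 0 else x $ i)"
      unfolding rotation_perturbation_row[OF n i] k_def m_def ..
    finally have row: "(complex_mat ?D *\<^sub>v x) $ i = (if i = 0 then k * x $ 0 + m * x $ 1
        else if i = 1 then k * x $ 1 - m * x $ 0 else x $ i)" .
    have x01: "x $ 0 = - (e * m)" "x $ 1 = 1 + e * k" using n unfolding x_def by auto
    consider "i = 0" | "i = 1" | "2 \<le> i" by linarith
    then show ?thesis
    proof cases
      case 1
      then show ?thesis unfolding row x01 by (simp add: x01[simplified] e_def[symmetric] algebra_simps)
    next
      case 2
      have "x $ 1 + f * (k * x $ 1 - m * x $ 0) = 1 + (e + f) * k + e * f * (k * k + m * m)"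
        unfolding x01 by (simp add: algebra_simps)
      also have "\<dots> = 0" using z unfolding km by simp
      finally show ?thesis using 2 unfolding row f_def by simp
    next
      case 3
      then have "x $ i = 0" using i unfolding x_def by simp
      then show ?thesis using 3 unfolding row by simp
    qed
  qed
  ultimately show ?thesis
    unfolding det_one_plus_diag_mult_eq_0_iff[OF C] using x by blast
qed

section \<open>Assembly of the two cases\<close>

theorem theorem3p1:
  fixes n :: nat and \<mu> :: "nat \<Rightarrow> real" and M :: "complex mat"
  assumes "n \<ge> 2"
    and "M = mat_diag n (\<lambda>i. cis (\<mu> (i + 1)))"
    and "\<mu> 1 < pi"
    and "\<And>i j. 1 \<le> i \<Longrightarrow> i \<le> j \<Longrightarrow> j \<le> n \<Longrightarrow> \<mu> j \<le> \<mu> i"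
    and "- pi / 2 < \<mu> n"
    and "\<mu> 1 - \<mu> n < pi"
  shows "(\<mu> 1 + \<mu> 2 \<le> pi \<longrightarrow>
            \<not> (\<exists>\<Delta> \<in> carrier_mat n n. pos_def_mat (\<Delta> + transpose_mat \<Delta>) \<and>
                  det (1\<^sub>m n + M * complex_mat \<Delta>) = 0) \<and>
            real_angular_stability_radius M = \<infinity>) \<and>
         (\<mu> 1 + \<mu> 2 > pi \<longrightarrow>
            real_angular_stability_radius M =
              ereal (arccos (- (cos ((\<mu> 1 + \<mu> 2) / 2) / cos ((\<mu> 1 - \<mu> 2) / 2)))))"
proof -
  obtain k where k: "n = Suc k" "1 \<le> k" using assms(1) by (cases n) auto
  define \<nu> where "\<nu> = (\<lambda>i. \<mu> (i + 1))"
  have \<nu>01: "\<nu> 0 = \<mu> 1" "\<nu> 1 = \<mu> 2" unfolding \<nu>_def by (simp_all add: numeral_2_eq_2)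
  have M: "M = mat_diag (Suc k) (\<lambda>i. cis (\<nu> i))" unfolding assms(2) k \<nu>_def ..
  have dM: "dim_row M = Suc k" unfolding M by (simp add: mat_diag_def)
  have le: "\<nu> i \<le> \<nu> 1" if "1 \<le> i" "i \<le> k" for i
    unfolding \<nu>_def using that k by (intro assms(4)) auto
  have le0: "\<nu> 1 \<le> \<nu> 0" unfolding \<nu>_def using k by (intro assms(4)) auto
  have last: "\<mu> n \<le> \<nu> i" if "i \<le> k" for i
    unfolding \<nu>_def using that k by (intro assms(4)) auto
  have low: "- pi / 2 < \<nu> i" and gap: "\<nu> 0 - \<nu> i < pi" if "i \<le> k" for i
    using last[OF that] assms(5,6) unfolding \<nu>01 by linarith+
  have up: "\<nu> 0 < pi" using assms(3) unfolding \<nu>01 .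
  \<comment> \<open>Positive definiteness of \<Delta> + \<Delta>^T and of the Hermitian part both
    reduce to positivity of the real form, so one set serves the nonexistence claim and the
    infimum.\<close>
  define F where "F = {\<Delta>. \<Delta> \<in> carrier_mat (Suc k) (Suc k) \<and>
    (\<forall>u \<in> carrier_vec (Suc k). u \<noteq> 0\<^sub>v (Suc k) \<longrightarrow> 0 < (\<Delta> *\<^sub>v u) \<bullet> u) \<and>
    det (1\<^sub>m (Suc k) + M * complex_mat \<Delta>) = 0}"
  have radius: "real_angular_stability_radius M = Inf ((\<lambda>\<Delta>. ereal (largest_phase (complex_mat \<Delta>))) ` F)"
    unfolding real_angular_stability_radius_def dM F_def
    using pos_def_mat_hermitian_part by (intro arg_cong[where f = Inf]) blast
  have F: "\<Delta> \<in> carrier_mat (Suc k) (Suc k)" "accretive_mat (Suc k) (complex_mat \<Delta>)"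
    "det (1\<^sub>m (Suc k) + mat_diag (Suc k) (\<lambda>i. cis (\<nu> i)) * complex_mat \<Delta>) = 0" if "\<Delta> \<in> F" for \<Delta>
    using that accretive_complex_mat unfolding F_def M by auto
  show ?thesis
  proof (intro conjI impI)
    assume sum: "\<mu> 1 + \<mu> 2 \<le> pi"
    have "F = {}"
      using no_singular_perturbation[OF F le le0 gap low up] sum unfolding \<nu>01 by blast
    then show "real_angular_stability_radius M = \<infinity>" unfolding radius by (simp add: top_ereal_def)
    show "\<not> (\<exists>\<Delta> \<in> carrier_mat n n. pos_def_mat (\<Delta> + transpose_mat \<Delta>) \<and>
                  det (1\<^sub>m n + M * complex_mat \<Delta>) = 0)"
      using \<open>F = {}\<close> pos_def_mat_add_transpose unfolding F_def k(1) by blast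
  next
    assume "\<mu> 1 + \<mu> 2 > pi"
    then have sum: "pi < \<nu> 0 + \<nu> 1" unfolding \<nu>01 .
    define \<kappa> where "\<kappa> = - (cos ((\<nu> 0 + \<nu> 1) / 2) / cos ((\<nu> 0 - \<nu> 1) / 2))"
    define \<theta> where "\<theta> = arccos \<kappa>"
    note trig = half_angle_facts[OF le0 up gap[OF k(2)] sum]
    have \<kappa>: "0 < \<kappa>" "\<kappa> < 1" using trig(5,6) unfolding \<kappa>_def by auto
    have cos\<theta>: "cos \<theta> = \<kappa>" unfolding \<theta>_def using \<kappa> by (intro cos_arccos) auto
    have \<theta>: "0 < \<theta>" "\<theta> < pi / 2"
      unfolding \<theta>_def using \<kappa> arccos_less_arccos[of \<kappa> 1] arccos_less_arccos[of 0 \<kappa>] by auto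
    have s: "0 < sin \<theta>" using \<theta> by (intro sin_gt_zero) auto
    have c: "0 < cos \<theta>" using \<kappa> unfolding cos\<theta> by simp
    let ?D = "rotation_perturbation (Suc k) \<theta>"
    have k2: "2 \<le> Suc k" using k by simp
    have "cos \<theta> * cos ((\<nu> 0 - \<nu> 1) / 2) = - cos ((\<nu> 0 + \<nu> 1) / 2)"
      unfolding cos\<theta> \<kappa>_def using trig(4) by simp
    from rotation_perturbation_singular[OF k2 s this]
    have D: "?D \<in> F"
      unfolding F_def M using rotation_perturbation_pos[OF k2 c] by simp
    note acc = F(2)[OF D]
    define \<phi> where "\<phi> = largest_phase (complex_mat ?D)"
    have \<phi>: "- pi / 2 < \<phi>" "\<phi> < pi / 2"
      and ex: "\<exists>y \<in> carrier_vec (Suc k). qform (complex_mat ?D) y = cis \<phi>"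
      using largest_phase_extremal[OF acc] unfolding \<phi>_def by auto
    from ex obtain y where y: "y \<in> carrier_vec (Suc k)" "qform (complex_mat ?D) y = cis \<phi>" by blast
    \<comment> \<open>The vector \<open>y\<close> attains \<open>cis \<phi>\<close>; were \<phi>
      larger than \<theta>, this value would lie outside the sector bounded by the angle
      \<theta>.\<close>
    have "\<phi> \<le> \<theta>"
    proof (rule ccontr)
      assume "\<not> \<phi> \<le> \<theta>"
      then have "0 < sin (\<phi> - \<theta>)" using \<theta> \<phi> by (intro sin_gt_zero) auto
      then show False
        using rotation_perturbation_phase[OF k2 c s y(1)] unfolding y(2) by (simp add: cis_mult)
    qed
    then have "Inf ((\<lambda>\<Delta>. ereal (largest_phase (complex_mat \<Delta>))) ` F) \<le> ereal \<theta>"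
      using D unfolding \<phi>_def by (intro INF_lower2[of ?D]) auto
    moreover have "ereal \<theta> \<le> Inf ((\<lambda>\<Delta>. ereal (largest_phase (complex_mat \<Delta>))) ` F)"
      using largest_phase_lower_bound[OF F k(2) le le0 gap up sum]
      unfolding \<theta>_def \<kappa>_def by (intro INF_greatest) auto
    ultimately show "real_angular_stability_radius M =
        ereal (arccos (- (cos ((\<mu> 1 + \<mu> 2) / 2) / cos ((\<mu> 1 - \<mu> 2) / 2))))"
      unfolding radius \<theta>_def \<kappa>_def \<nu>01[symmetric] by (rule antisym)
  qed
qed

end
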